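(* Let $M\in\mathbb{R}^{n\times n}$ be positive semidefinite with $\mathcal{F}^+\neq\emptyset$, let $\varepsilon>0$, $\beta=\frac14$, $\tau=\omega_*\!\left(\frac{2\beta}{1-\beta}\right)$, and let $\mathbf{z}^{(0)}=(\mathbf{x}^{(0)},\mathbf{s}^{(0)},\mathbf{w}^{(0)})\in\mathcal{N}_\delta(\beta)\subset\mathcal{F}_z^+$ be the starting point. If the predictor right-hand side is $\mathbf{a}_p(\mathbf{z})=\mathbf{a}_{ut}(\mathbf{z})$ or $\mathbf{a}_p(\mathbf{z})=\mathbf{a}_{ac}(\mathbf{z})$, then the PTS IPA (described in the context) gives a feasible solution $(\mathbf{x},\mathbf{s})\in\mathcal{F}$ of the LCP with $\mathbf{x}^T\mathbf{s}\le\varepsilon$ after at most $$\left\lceil 4\sqrt{n}\,\ln\frac{\mu^*(\mathbf{w}^{(0)})}{\varepsilon}\right\rceil$$ iterations (passes through the outer loop of the algorithm; the expression is read as $0$ if it is negative).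
   Context: Setting. $n\ge 1$, $M\in\mathbb{R}^{n\times n}$ is positive semidefinite ($\mathbf{x}^TM\mathbf{x}\ge0$ for all $\mathbf{x}$; not necessarily symmetric), $\mathbf{q}\in\mathbb{R}^n$. The LCP is: find $\mathbf{x},\mathbf{s}\ge 0$ with $-M\mathbf{x}+\mathbf{s}=\mathbf{q}$, $\mathbf{x}\mathbf{s}=\mathbf{0}$. All operations on vectors (products, squares, quotients, roots) are componentwise; $\|\cdot\|$ is the Euclidean norm; $\mathbf{e}\in\mathbb{R}^n$ and $\bar{\mathbf{e}}\in\mathbb{R}^{n+1}$ are all-ones vectors. $\mathcal{F}=\{(\mathbf{x},\mathbf{s}): \mathbf{x},\mathbf{s}\ge0,\ -M\mathbf{x}+\mathbf{s}=\mathbf{q}\}$, $\mathcal{F}^+=\{(\mathbf{x},\mathbf{s})\in\mathcal{F}:\mathbf{x},\mathbf{s}>0\}$. For $\mathbf{w}=(v_0,\mathbf{v})\in\mathbb{R}\times\mathbb{R}^n$: $\mathcal{F}_w^+=\{\mathbf{w}: v_0>\|\mathbf{v}\|^2\}$, $\rho(\mathbf{w})=\frac{v_0-\|\mathbf{v}\|^2}{n+1}$, $\mu^*(\mathbf{w})=\frac{v_0^2}{v_0-\|\mathbf{v}\|^2}$. $\mathcal{F}_z^+=\{\mathbf{z}=(\mathbf{x},\mathbf{s},\mathbf{w}):(\mathbf{x},\mathbf{s})\in\mathcal{F}^+,\ \mathbf{w}\in\mathcal{F}_w^+,\ \mathbf{x}\mathbf{s}>\mathbf{v}^2,\ \mathbf{x}^T\mathbf{s}<v_0\}$.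 For $\mathbf{z}\in\mathcal{F}_z^+$: $r_0(\mathbf{z})=v_0-\mathbf{x}^T\mathbf{s}$, $r_i(\mathbf{z})=x_is_i-v_i^2$ ($1\le i\le n$), $\hat{\mathbf{r}}(\mathbf{z})=\sqrt{\mathbf{r}(\mathbf{z})/\rho(\mathbf{w})}\in\mathbb{R}^{n+1}$, $F(\mathbf{z})=-\sum_{i=0}^n\ln r_i(\mathbf{z})$, $\Psi(\mathbf{z})=-\sum_{i=0}^n\ln \hat r_i^2(\mathbf{z})$, $\zeta_0(\mathbf{z})=\|\hat{\mathbf{r}}(\mathbf{z})-1/\hat{\mathbf{r}}(\mathbf{z})\|$, $\zeta_1(\mathbf{z})=\|1/\hat{\mathbf{r}}^2(\mathbf{z})-\bar{\mathbf{e}}\|$, $\delta(\mathbf{z})=\zeta_0^2(\mathbf{z})/\zeta_1(\mathbf{z})$ (and $\delta(\mathbf{z})=0$ if $\zeta_1(\mathbf{z})=0$). $\mathcal{N}_\delta(\beta)=\{\mathbf{z}\in\mathcal{F}_z^+:\delta(\mathbf{z})\le\beta\}$, $\mathcal{N}_\Psi(\tau)=\{\mathbf{z}\in\mathcal{F}_z^+:\Psi(\mathbf{z})\le\tau\}$. $\omega_*(t)=-t-\ln(1-t)$ for $t\in[0,1)$. Directions: given $\mathbf{z}\in\mathcal{F}_z^+$ and $\mathbf{a}\in\mathbb{R}^n$, $(\Delta\mathbf{x},\Delta\mathbf{s})$ is the unique solution of $-M\Delta\mathbf{x}+\Delta\mathbf{s}=\mathbf{0}$, $\mathbf{s}\Delta\mathbf{x}+\mathbf{x}\Delta\mathbf{s}=\mathbf{a}$.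 Right-hand sides: corrector $\mathbf{a}_c(\mathbf{z})=\rho(\mathbf{w})\mathbf{e}-\mathbf{x}\mathbf{s}+\mathbf{v}^2$; universal tangent $\mathbf{a}_{ut}(\mathbf{z})=\left(\frac{\|\mathbf{v}\|^2}{n+1}-\rho(\mathbf{w})\right)\mathbf{e}-2\mathbf{v}^2$; auto-corrector $\mathbf{a}_{ac}(\mathbf{z})=\mathbf{a}_{ut}(\mathbf{z})+\mathbf{a}_c(\mathbf{z})=\frac{\|\mathbf{v}\|^2}{n+1}\mathbf{e}-\mathbf{v}^2-\mathbf{x}\mathbf{s}$. Algorithm (PTS IPA) with parameters $\varepsilon>0$, $\beta\in(0,\frac13)$, $\tau=\omega_*(\frac{2\beta}{1-\beta})$ and starting point $\mathbf{z}^{(0)}\in\mathcal{N}_\delta(\beta)$. Set $\mathbf{z}=(\mathbf{x},\mathbf{s},\mathbf{w}):=\mathbf{z}^{(0)}$. While $v_0>\varepsilon$ (outer loop): (Predictor) compute $(\Delta\mathbf{x},\Delta\mathbf{s})$ with $\mathbf{a}=\mathbf{a}_p(\mathbf{z})$; let $\alpha_p=\max\{\alpha\in[0,1]:(\mathbf{x}+\alpha\Delta\mathbf{x},\mathbf{s}+\alpha\Delta\mathbf{s},(1-\alpha)\mathbf{w})\in\mathcal{N}_\Psi(\tau)\}$; replace $\mathbf{z}$ by $(\mathbf{x}+\alpha_p\Delta\mathbf{x},\mathbf{s}+\alpha_p\Delta\mathbf{s},(1-\alpha_p)\mathbf{w})$. (Correctors) while $\mathbf{z}\notin\mathcal{N}_\delta(\beta)$: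 compute $(\Delta\mathbf{x},\Delta\mathbf{s})$ with $\mathbf{a}=\mathbf{a}_c(\mathbf{z})$; let $\alpha_c$ minimize $F(\mathbf{x}+\alpha\Delta\mathbf{x},\mathbf{s}+\alpha\Delta\mathbf{s},\mathbf{w})$ over those $\alpha\in[0,1]$ for which the argument lies in $\mathcal{F}_z^+$; replace $(\mathbf{x},\mathbf{s})$ by $(\mathbf{x}+\alpha_c\Delta\mathbf{x},\mathbf{s}+\alpha_c\Delta\mathbf{s})$, keeping $\mathbf{w}$. A run of the algorithm presupposes that the maximum defining $\alpha_p$ is attained in each predictor step performed. *)

theory Defs
  imports "HOL-Analysis.Analysis"
begin

text \<open>
  Dimension $n$ is \<open>CARD('n)\<close>. Products and powers of vectors are the componentwise ones of
  the type \<open>real ^ 'n\<close>, and \<open>1\<close> is the all-ones vector. Vectors of $n+1$ components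
  indexed $0, 1, \dots, n$ have type \<open>real ^ 'n option\<close>, with \<open>None\<close> for the index $0$.
  Points $(x, s, (v_0, v))$ are nested pairs.
\<close>

type_synonym 'n par = "real \<times> (real ^ 'n)"
type_synonym 'n point = "(real ^ 'n) \<times> (real ^ 'n) \<times> 'n par"

definition pos_semidef :: "real ^ 'n ^ 'n \<Rightarrow> bool" where
  "pos_semidef M \<longleftrightarrow> (\<forall>x. 0 \<le> x \<bullet> (M *v x))"

definition feas :: "real ^ 'n ^ 'n \<Rightarrow> real ^ 'n \<Rightarrow> ((real ^ 'n) \<times> (real ^ 'n)) set" where
  "feas M q = {(x, s). (\<forall>i. 0 \<le> x $ i) \<and> (\<forall>i. 0 \<le> s $ i) \<and> - (M *v x) + s = q}"

definition feas_pos :: "real ^ 'n ^ 'n \<Rightarrow> real ^ 'n \<Rightarrow> ((real ^ 'n) \<times> (real ^ 'n)) set" where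
  "feas_pos M q = {(x, s) \<in> feas M q. (\<forall>i. 0 < x $ i) \<and> (\<forall>i. 0 < s $ i)}"

definition feas_w :: "'n::finite par set" where
  "feas_w = {(v0, v). v0 > (norm v)\<^sup>2}"

fun rho :: "'n::finite par \<Rightarrow> real" where
  "rho (v0, v) = (v0 - (norm v)\<^sup>2) / (real CARD('n) + 1)"

fun mu_star :: "'n::finite par \<Rightarrow> real" where
  "mu_star (v0, v) = v0\<^sup>2 / (v0 - (norm v)\<^sup>2)"

definition feas_z :: "real ^ 'n ^ 'n \<Rightarrow> real ^ 'n \<Rightarrow> 'n::finite point set" where
  "feas_z M q = {(x, s, (v0, v)). (x, s) \<in> feas_pos M q \<and> (v0, v) \<in> feas_w \<and>
     (\<forall>i. (x * s) $ i > (v\<^sup>2) $ i) \<and> x \<bullet> s < v0}"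

fun res :: "'n::finite point \<Rightarrow> real ^ 'n option" where
  "res (x, s, (v0, v)) =
     (\<chi> j. case j of None \<Rightarrow> v0 - x \<bullet> s | Some i \<Rightarrow> x $ i * s $ i - (v $ i)\<^sup>2)"

fun rhat :: "'n::finite point \<Rightarrow> real ^ 'n option" where
  "rhat (x, s, w) = (\<chi> j. sqrt (res (x, s, w) $ j / rho w))"

definition barrier :: "'n::finite point \<Rightarrow> real" where
  "barrier z = - (\<Sum>j\<in>UNIV. ln (res z $ j))"

definition Psi :: "'n::finite point \<Rightarrow> real" where
  "Psi z = - (\<Sum>j\<in>UNIV. ln ((rhat z $ j)\<^sup>2))"

definition zeta0 :: "'n::finite point \<Rightarrow> real" where
  "zeta0 z = norm (rhat z - (\<chi> j. 1 / rhat z $ j))"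

definition zeta1 :: "'n::finite point \<Rightarrow> real" where
  "zeta1 z = norm ((\<chi> j. 1 / (rhat z $ j)\<^sup>2) - 1)"

definition prox :: "'n::finite point \<Rightarrow> real" where
  "prox z = (if zeta1 z = 0 then 0 else (zeta0 z)\<^sup>2 / zeta1 z)"

definition N_prox :: "real ^ 'n ^ 'n \<Rightarrow> real ^ 'n \<Rightarrow> real \<Rightarrow> 'n::finite point set" where
  "N_prox M q \<beta> = {z \<in> feas_z M q. prox z \<le> \<beta>}"

definition N_Psi :: "real ^ 'n ^ 'n \<Rightarrow> real ^ 'n \<Rightarrow> real \<Rightarrow> 'n::finite point set" where
  "N_Psi M q \<tau> = {z \<in> feas_z M q. Psi z \<le> \<tau>}"

definition omega_star :: "real \<Rightarrow> real" where
  "omega_star t = - t - ln (1 - t)"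

text \<open>\<open>is_direction M z a dx ds\<close>: \<open>(dx, ds)\<close> solves the linear system with right-hand side \<open>a\<close>;
  the solution is unique if \<open>M\<close> is positive semidefinite and \<open>x, s > 0\<close>.\<close>

fun is_direction ::
  "real ^ 'n ^ 'n \<Rightarrow> 'n::finite point \<Rightarrow> real ^ 'n \<Rightarrow> real ^ 'n \<Rightarrow> real ^ 'n \<Rightarrow> bool" where
  "is_direction M (x, s, w) a dx ds \<longleftrightarrow> - (M *v dx) + ds = 0 \<and> s * dx + x * ds = a"

fun a_c :: "'n::finite point \<Rightarrow> real ^ 'n" where
  "a_c (x, s, (v0, v)) = rho (v0, v) *\<^sub>R 1 - x * s + v\<^sup>2"

fun a_ut :: "'n::finite point \<Rightarrow> real ^ 'n" where
  "a_ut (x, s, (v0, v)) =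
     ((norm v)\<^sup>2 / (real CARD('n) + 1) - rho (v0, v)) *\<^sub>R 1 - 2 *\<^sub>R v\<^sup>2"

definition a_ac :: "'n::finite point \<Rightarrow> real ^ 'n" where
  "a_ac z = a_ut z + a_c z"

fun pred_point :: "'n::finite point \<Rightarrow> real ^ 'n \<Rightarrow> real ^ 'n \<Rightarrow> real \<Rightarrow> 'n point" where
  "pred_point (x, s, w) dx ds \<alpha> = (x + \<alpha> *\<^sub>R dx, s + \<alpha> *\<^sub>R ds, (1 - \<alpha>) *\<^sub>R w)"

fun corr_point :: "'n::finite point \<Rightarrow> real ^ 'n \<Rightarrow> real ^ 'n \<Rightarrow> real \<Rightarrow> 'n point" where
  "corr_point (x, s, w) dx ds \<alpha> = (x + \<alpha> *\<^sub>R dx, s + \<alpha> *\<^sub>R ds, w)"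

definition is_pred_length ::
  "real ^ 'n ^ 'n \<Rightarrow> real ^ 'n \<Rightarrow> real \<Rightarrow> 'n::finite point \<Rightarrow> real ^ 'n \<Rightarrow> real ^ 'n \<Rightarrow> real \<Rightarrow> bool"
where
  "is_pred_length M q \<tau> z dx ds =
     is_arg_max (\<lambda>\<alpha>. \<alpha>) (\<lambda>\<alpha>. \<alpha> \<in> {0..1} \<and> pred_point z dx ds \<alpha> \<in> N_Psi M q \<tau>)"

definition is_corr_length ::
  "real ^ 'n ^ 'n \<Rightarrow> real ^ 'n \<Rightarrow> 'n::finite point \<Rightarrow> real ^ 'n \<Rightarrow> real ^ 'n \<Rightarrow> real \<Rightarrow> bool"
where
  "is_corr_length M q z dx ds =
     is_arg_min (\<lambda>\<alpha>. barrier (corr_point z dx ds \<alpha>))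
       (\<lambda>\<alpha>. \<alpha> \<in> {0..1} \<and> corr_point z dx ds \<alpha> \<in> feas_z M q)"

text \<open>The algorithm is a transition system. In state \<open>Outer z\<close> the test \<open>v0 > \<epsilon>\<close> of the outer loop
  is about to be evaluated, in state \<open>Inner z\<close> the test \<open>z \<notin> N_prox M q \<beta>\<close> of the corrector loop.\<close>

datatype 'n config = Outer "'n point" | Inner "'n point"

inductive pts_step ::
  "real ^ 'n ^ 'n \<Rightarrow> real ^ 'n \<Rightarrow> real \<Rightarrow> real \<Rightarrow> real \<Rightarrow> ('n::finite point \<Rightarrow> real ^ 'n) \<Rightarrow>
   'n config \<Rightarrow> 'n config \<Rightarrow> bool"
  for M q \<epsilon> \<beta> \<tau> ap
where
  predictor: "z = (x, s, (v0, v)) \<Longrightarrow> v0 > \<epsilon> \<Longrightarrow>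
     is_direction M z (ap z) dx ds \<Longrightarrow> is_pred_length M q \<tau> z dx ds \<alpha> \<Longrightarrow>
     pts_step M q \<epsilon> \<beta> \<tau> ap (Outer z) (Inner (pred_point z dx ds \<alpha>))"
| corrector: "z \<notin> N_prox M q \<beta> \<Longrightarrow>
     is_direction M z (a_c z) dx ds \<Longrightarrow> is_corr_length M q z dx ds \<alpha> \<Longrightarrow>
     pts_step M q \<epsilon> \<beta> \<tau> ap (Inner z) (Inner (corr_point z dx ds \<alpha>))"
| inner_exit: "z \<in> N_prox M q \<beta> \<Longrightarrow> pts_step M q \<epsilon> \<beta> \<tau> ap (Inner z) (Outer z)"

text \<open>A maximal execution \<open>c 0, c 1, \<dots>\<close> of \<open>L\<close> steps, where \<open>L = \<infinity>\<close> stands for nontermination and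
  the values \<open>c k\<close> with \<open>k > L\<close> are irrelevant. A finite execution ends only where no step is
  possible. This is normal termination (\<open>Outer z\<close> with \<open>v0 \<le> \<epsilon>\<close>) or a failure of the algorithm, when
  the search direction or the step length required next does not exist.\<close>

definition maximal_execution ::
  "real ^ 'n ^ 'n \<Rightarrow> real ^ 'n \<Rightarrow> real \<Rightarrow> real \<Rightarrow> real \<Rightarrow> ('n::finite point \<Rightarrow> real ^ 'n) \<Rightarrow>
   'n point \<Rightarrow> enat \<Rightarrow> (nat \<Rightarrow> 'n config) \<Rightarrow> bool"
where
  "maximal_execution M q \<epsilon> \<beta> \<tau> ap z0 L c \<longleftrightarrow>
     c 0 = Outer z0 \<and>
     (\<forall>k. enat k < L \<longrightarrow> pts_step M q \<epsilon> \<beta> \<tau> ap (c k) (c (Suc k))) \<and>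
     (\<forall>k. enat k = L \<longrightarrow> \<not> (\<exists>c'. pts_step M q \<epsilon> \<beta> \<tau> ap (c k) c'))"

text \<open>Runs of the algorithm are the maximal executions in which the maximum that defines the predictor
  step length is attained whenever it is needed (the supremum may be the excluded value \<open>1\<close>). Nothing
  of this kind is presupposed for the corrector steps.\<close>

definition pts_run ::
  "real ^ 'n ^ 'n \<Rightarrow> real ^ 'n \<Rightarrow> real \<Rightarrow> real \<Rightarrow> real \<Rightarrow> ('n::finite point \<Rightarrow> real ^ 'n) \<Rightarrow>
   'n point \<Rightarrow> enat \<Rightarrow> (nat \<Rightarrow> 'n config) \<Rightarrow> bool"
where
  "pts_run M q \<epsilon> \<beta> \<tau> ap z0 L c \<longleftrightarrow>
     maximal_execution M q \<epsilon> \<beta> \<tau> ap z0 L c \<and>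
     (\<forall>k x s v0 v dx ds. enat k \<le> L \<longrightarrow> c k = Outer (x, s, (v0, v)) \<longrightarrow> v0 > \<epsilon> \<longrightarrow>
        is_direction M (x, s, (v0, v)) (ap (x, s, (v0, v))) dx ds \<longrightarrow>
        (\<exists>\<alpha>. is_pred_length M q \<tau> (x, s, (v0, v)) dx ds \<alpha>))"

text \<open>Each pass through the body of the outer loop leaves exactly one state \<open>Outer z\<close>.\<close>

definition outer_iterations :: "(nat \<Rightarrow> 'n config) \<Rightarrow> nat \<Rightarrow> nat" where
  "outer_iterations c K = card {k. k < K \<and> (\<exists>z. c k = Outer z)}"

end

theory Submission
  imports Defs
begin

text \<open>
  Write \<open>r\<close> for the vector of the \<open>n + 1\<close> residuals of a point. The complementarity products cancel
  in its sum, which is \<open>v0 - \<parallel>v\<parallel>\<^sup>2 = (n + 1) \<rho>\<close>. So \<open>u = r / \<rho>\<close> has mean \<open>1\<close>, and \<open>Psi = - \<Sum> ln u\<^sub>j\<close>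
  and the proximity measure both express how far \<open>u\<close> is from the all-ones vector. Two facts about
  such vectors link the two neighbourhoods: proximity at most \<open>\<beta>\<close> forces \<open>\<parallel>u - 1\<parallel> \<le> \<beta> / (1 - \<beta>)\<close>
  (\<open>centrality_bounds\<close>), and conversely \<open>\<parallel>u - 1\<parallel> \<le> R < 1\<close> forces \<open>Psi \<le> omega_star R\<close>
  (\<open>log_barrier_le_omega_star\<close>). For \<open>\<beta> = 1/4\<close> these radii are \<open>1/3\<close> and, at the threshold \<open>\<tau>\<close>,
  \<open>2/3\<close>: a predictor step may double the distance to the centre.

  The predictor right-hand side is chosen so that \<open>r - \<rho> 1\<close> changes, apart from a damping factor
  \<open>1 - \<theta> \<alpha>\<close>, only to second order in the step length \<open>\<alpha>\<close> (\<open>res_pred_point\<close>; \<open>\<theta> = 0\<close> is the universal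
  tangent, \<open>\<theta> = 1\<close> the auto-corrector). Monotonicity of \<open>M\<close> bounds the products \<open>\<Delta>x \<Delta>s\<close>
  (\<open>norm_lift_product_le\<close>), and with \<open>\<kappa> = \<parallel>v\<parallel>\<^sup>2 / (v0 - \<parallel>v\<parallel>\<^sup>2)\<close> the second-order term is at most
  \<open>1.28 n \<rho> (1 + \<kappa>)\<^sup>2 \<alpha>\<^sup>2\<close>. Hence every \<open>\<alpha> \<ge> 0\<close> with \<open>\<alpha> (1 + \<kappa>) \<surd>n \<le> 5/16\<close> is admissible, and the longest
  admissible step is at least that long. Such a step multiplies \<open>\<mu>\<^sup>*\<close> by
  \<open>(1 - \<alpha>) / (1 + \<alpha> \<kappa>) \<le> 1 / (1 + \<alpha> (1 + \<kappa>)) \<le> exp (- 1 / (4 \<surd>n))\<close> (\<open>mu_star_shrink\<close>). Corrector steps do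
  not move \<open>w\<close>, and \<open>v0 \<le> \<mu>\<^sup>*\<close>, so \<open>v0 > \<epsilon>\<close> can hold at the beginning of fewer than
  \<open>4 \<surd>n ln (\<mu>\<^sup>* / \<epsilon>) + 1\<close> passes.

  The corrector loop ends because \<open>Psi\<close> is nonnegative, starts below \<open>\<tau>\<close> and, as long as the
  proximity exceeds \<open>\<beta>\<close>, decreases in each step by an amount that depends only on \<open>n\<close>, \<open>\<beta>\<close> and \<open>\<tau>\<close>
  (\<open>corrector_step_decrease\<close>). The directions and the corrector step lengths exist
  (\<open>direction_exists\<close>, \<open>corrector_length_exists\<close>), so an execution can only stop at a point with
  \<open>v0 \<le> \<epsilon>\<close>. A real-valued potential combines both progress measures and bounds the length of the
  execution.
\<close>

section \<open>Logarithmic barriers of vectors with mean one\<close>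

lemma omega_star_ge_half_square:
  fixes t :: real
  assumes "0 \<le> t" "t < 1"
  shows "t\<^sup>2 / 2 \<le> omega_star t"
proof -
  let ?f = "\<lambda>u::real. omega_star u - u\<^sup>2 / 2"
  have "?f 0 \<le> ?f t"
  proof (rule DERIV_nonneg_imp_nondecreasing[OF assms(1)])
    fix u :: real assume u: "0 \<le> u" "u \<le> t"
    then have "u < 1" using assms by simp
    then have "(?f has_real_derivative (1 / (1 - u) - 1 - u)) (at u)"
      unfolding omega_star_def by (auto intro!: derivative_eq_intros simp: field_simps)
    moreover have "1 / (1 - u) - 1 - u \<ge> 0"
      using \<open>u < 1\<close> u by (simp add: field_simps)
    ultimately show "\<exists>y. (?f has_real_derivative y) (at u) \<and> 0 \<le> y" by blast
  qed
  then show ?thesis by (simp add: omega_star_def)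
qed

text \<open>
  The quotient \<open>(x - ln (1 + x)) / x\<^sup>2\<close> decreases on \<open>(-1, \<infinity>)\<close>, so on \<open>[-R, \<infinity>)\<close> its largest value is
  the one at \<open>-R\<close>. With that value as \<open>c\<close>, the function \<open>c x\<^sup>2 - x + ln (1 + x)\<close> vanishes at
  \<open>-R\<close> and at \<open>0\<close>. Its derivative \<open>x (2 c - 1 / (1 + x))\<close> is nonnegative up to the point where
  \<open>2 c (1 + x) = 1\<close>, nonpositive from there to \<open>0\<close>, and nonnegative after \<open>0\<close>, since \<open>2 c \<ge> 1\<close>.
\<close>
lemma ln_quadratic_lower_bound:
  fixes R x :: real
  assumes R: "0 < R" "R < 1" and x: "- R \<le> x"
  shows "x - ln (1 + x) \<le> omega_star R / R\<^sup>2 * x\<^sup>2"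
proof -
  define c where "c = omega_star R / R\<^sup>2"
  define f where "f = (\<lambda>u. c * u\<^sup>2 - u + ln (1 + u))"
  have c: "2 * c \<ge> 1"
    using omega_star_ge_half_square[of R] R by (simp add: c_def field_simps)
  have f0: "f 0 = 0" by (simp add: f_def)
  have fR: "f (- R) = 0" using R by (simp add: f_def c_def omega_star_def)
  have df: "(f has_real_derivative u * (2 * c - 1 / (1 + u))) (at u)" if "-1 < u" for u
    using that unfolding f_def by (auto intro!: derivative_eq_intros simp: field_simps)
  have "0 \<le> f x"
  proof (cases "0 \<le> x")
    case True
    have "f 0 \<le> f x"
    proof (rule DERIV_nonneg_imp_nondecreasing[OF True])
      fix u :: real assume u: "0 \<le> u" "u \<le> x"
      have "1 / (1 + u) \<le> 1" using u by simp
      then have "0 \<le> u * (2 * c - 1 / (1 + u))"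
        using c u by (intro mult_nonneg_nonneg) linarith+
      then show "\<exists>y. (f has_real_derivative y) (at u) \<and> 0 \<le> y"
        using df[of u] u by auto
    qed
    then show ?thesis by (simp add: f0)
  next
    case neg: False
    show ?thesis
    proof (cases "2 * c * (1 + x) \<le> 1")
      case True
      have "f (- R) \<le> f x"
      proof (rule DERIV_nonneg_imp_nondecreasing[OF x])
        fix u :: real assume u: "- R \<le> u" "u \<le> x"
        have pos: "1 + u > 0" using u R by simp
        have "2 * c * (1 + u) \<le> 2 * c * (1 + x)" using u c by (intro mult_left_mono) auto
        then have "2 * c \<le> 1 / (1 + u)" using True pos by (simp add: field_simps)
        then have "0 \<le> u * (2 * c - 1 / (1 + u))"
          using u neg by (intro mult_nonpos_nonpos) auto
        then show "\<exists>y. (f has_real_derivative y) (at u) \<and> 0 \<le> y"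
          using df[of u] pos by auto
      qed
      then show ?thesis by (simp add: fR)
    next
      case False
      have "f x \<ge> f 0"
      proof (rule DERIV_nonpos_imp_nonincreasing[of x 0])
        show "x \<le> 0" using neg by simp
        fix u :: real assume u: "x \<le> u" "u \<le> 0"
        have pos: "1 + u > 0" using u R x by simp
        have "2 * c * (1 + x) \<le> 2 * c * (1 + u)" using u c by (intro mult_left_mono) auto
        then have "1 / (1 + u) \<le> 2 * c" using False pos by (simp add: field_simps)
        then have "u * (2 * c - 1 / (1 + u)) \<le> 0"
          using u by (intro mult_nonpos_nonneg) auto
        then show "\<exists>y. (f has_real_derivative y) (at u) \<and> y \<le> 0"
          using df[of u] pos by auto
      qed
      then show ?thesis by (simp add: f0)
    qed
  qed
  then show ?thesis by (simp add: f_def c_def)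
qed

lemma norm_square_sum: "(norm (x :: real ^ 'a))\<^sup>2 = (\<Sum>j\<in>UNIV. (x $ j)\<^sup>2)"
  unfolding power2_norm_eq_inner inner_vec_def by (simp add: power2_eq_square)

text \<open>
  Because the deviations sum to zero, only the quadratic terms of the componentwise bounds survive
  the summation.
\<close>
lemma log_barrier_le_omega_star:
  fixes D :: "real ^ 'a"
  assumes "0 < R" "R < 1" and sum0: "(\<Sum>j\<in>UNIV. D $ j) = 0" and nD: "norm D \<le> R"
  shows "- (\<Sum>j\<in>UNIV. ln (1 + D $ j)) \<le> omega_star R"
proof -
  let ?c = "omega_star R / R\<^sup>2"
  have om: "0 \<le> omega_star R"
    using omega_star_ge_half_square[of R] assms(1,2) by (smt (verit) zero_le_power2 divide_nonneg_nonneg)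
  have "D $ j - ln (1 + D $ j) \<le> ?c * (D $ j)\<^sup>2" for j
  proof (rule ln_quadratic_lower_bound)
    show "- R \<le> D $ j" using component_le_norm_cart[of D j] nD by simp
  qed (use assms in auto)
  then have "(\<Sum>j\<in>UNIV. D $ j - ln (1 + D $ j)) \<le> (\<Sum>j\<in>UNIV. ?c * (D $ j)\<^sup>2)"
    by (rule sum_mono)
  also have "\<dots> = ?c * (norm D)\<^sup>2"
    by (simp add: norm_square_sum sum_distrib_left)
  also have "\<dots> \<le> ?c * R\<^sup>2"
    using nD om by (intro mult_left_mono power_mono) auto
  also have "\<dots> = omega_star R" using assms(1) by simp
  finally show ?thesis using sum0 by (simp add: sum_subtractf)
qed

text \<open>
  With \<open>p = 1 / u - 1\<close>, the sum \<open>G\<close> of the \<open>p\<^sub>j\<close> equals \<open>\<Sum> u\<^sub>j p\<^sub>j\<^sup>2\<close>, as the \<open>u\<^sub>j - 1\<close> cancel. Since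
  \<open>u\<^sub>j \<ge> 1 / (1 + \<parallel>p\<parallel>)\<close>, this is at least \<open>\<parallel>p\<parallel>\<^sup>2 / (1 + \<parallel>p\<parallel>)\<close>, and the hypothesis bounds \<open>\<parallel>p\<parallel>\<close>,
  hence \<open>G\<close>. For the second bound, \<open>y = \<parallel>u - 1\<parallel>\<close> satisfies \<open>y\<^sup>2 = \<Sum> u\<^sub>j (u\<^sub>j p\<^sub>j\<^sup>2) \<le> (1 + y) G\<close>.
\<close>
lemma centrality_bounds:
  fixes u :: "real ^ 'a" and \<beta> :: real
  defines "p \<equiv> (\<chi> j. 1 / u $ j - 1)"
  assumes b: "0 < \<beta>" "\<beta> < 1"
    and pos: "\<And>j. 0 < u $ j" and sum0: "(\<Sum>j\<in>UNIV. u $ j - 1) = 0"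
    and prox: "(\<Sum>j\<in>UNIV. 1 / u $ j - 1) \<le> \<beta> * norm p"
  shows "1 - \<beta> \<le> u $ j" and "norm (u - 1) \<le> \<beta> / (1 - \<beta>)"
proof -
  define G where "G = (\<Sum>j\<in>UNIV. 1 / u $ j - 1)"
  have pj: "p $ j = 1 / u $ j - 1" for j by (simp add: p_def)
  have "u $ j * (p $ j)\<^sup>2 = (1 / u $ j - 1) + (u $ j - 1)" for j
    using pos[of j] by (simp add: pj field_simps power2_eq_square)
  then have G: "(\<Sum>j\<in>UNIV. u $ j * (p $ j)\<^sup>2) = G"
    using sum0 by (simp only: sum.distrib G_def)
  have u_ge: "1 / (1 + norm p) \<le> u $ j" for j
  proof -
    have "1 / u $ j \<le> 1 + norm p" using component_le_norm_cart[of p j] pj[of j] by simp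
    then have "1 \<le> u $ j * (1 + norm p)" using pos[of j] by (simp add: field_simps)
    moreover have "0 < 1 + norm p" by (simp add: add_pos_nonneg)
    ultimately show ?thesis by (simp add: pos_divide_le_eq)
  qed
  have "1 / (1 + norm p) * (norm p)\<^sup>2 = (\<Sum>j\<in>UNIV. 1 / (1 + norm p) * (p $ j)\<^sup>2)"
    by (simp add: norm_square_sum sum_distrib_left)
  also have "\<dots> \<le> G"
    unfolding G[symmetric] by (intro sum_mono mult_right_mono u_ge) auto
  finally have "1 / (1 + norm p) * (norm p)\<^sup>2 \<le> \<beta> * norm p"
    using prox G_def by simp
  then have "norm p * norm p \<le> (\<beta> * (1 + norm p)) * norm p"
    by (simp add: field_simps add_pos_nonneg power2_eq_square)
  then have "norm p \<le> \<beta> * (1 + norm p) \<or> norm p = 0"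
    by (metis mult_right_le_imp_le norm_ge_zero order_less_le)
  then have np: "norm p * (1 - \<beta>) \<le> \<beta>"
    using b by (auto simp: algebra_simps)
  then have np': "norm p \<le> \<beta> / (1 - \<beta>)" using b by (simp add: field_simps)
  have ub: "1 - \<beta> \<le> u $ j" for j
  proof -
    have "(1 - \<beta>) * (1 + norm p) \<le> 1" using np by (simp add: algebra_simps)
    moreover have "0 < 1 + norm p" by (simp add: add_pos_nonneg)
    ultimately have "1 - \<beta> \<le> 1 / (1 + norm p)" by (subst pos_le_divide_eq)
    then show ?thesis using u_ge[of j] by simp
  qed
  then show "1 - \<beta> \<le> u $ j" .
  define y where "y = norm (u - 1)"
  have u_le: "u $ j \<le> 1 + y" for j
    using component_le_norm_cart[of "u - 1" j] by (simp add: y_def)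
  have "y\<^sup>2 = (\<Sum>j\<in>UNIV. u $ j * (u $ j * (p $ j)\<^sup>2))"
    unfolding y_def norm_square_sum
  proof (intro sum.cong refl)
    fix j show "((u - 1) $ j)\<^sup>2 = u $ j * (u $ j * (p $ j)\<^sup>2)"
      using pos[of j] by (simp add: pj field_simps power2_eq_square)
  qed
  also have "\<dots> \<le> (\<Sum>j\<in>UNIV. (1 + y) * (u $ j * (p $ j)\<^sup>2))"
    using pos by (intro sum_mono mult_right_mono u_le) (simp add: less_imp_le)
  also have "\<dots> = (1 + y) * G" by (simp add: G[symmetric] sum_distrib_left)
  also have "\<dots> \<le> (1 + y) * (\<beta> * (\<beta> / (1 - \<beta>)))"
  proof (intro mult_left_mono)
    have "G \<le> \<beta> * norm p" using prox G_def by simp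
    also have "\<dots> \<le> \<beta> * (\<beta> / (1 - \<beta>))" using np' b by (intro mult_left_mono) auto
    finally show "G \<le> \<beta> * (\<beta> / (1 - \<beta>))" .
  qed (simp add: y_def)
  \<comment> \<open>The roots of \<open>y\<^sup>2 - (1 + y) \<beta>\<^sup>2 / (1 - \<beta>)\<close> are \<open>\<beta> / (1 - \<beta>)\<close> and \<open>- \<beta>\<close>.\<close>
  finally have "(y - \<beta> / (1 - \<beta>)) * (y + \<beta>) \<le> 0"
    using b by (simp add: field_simps power2_eq_square)
  moreover have "y + \<beta> > 0" using b by (simp add: y_def add_nonneg_pos)
  ultimately show "norm (u - 1) \<le> \<beta> / (1 - \<beta>)"
    unfolding y_def[symmetric] by (simp add: mult_le_0_iff)
qed

section \<open>Residual vectors with zero sum\<close>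

text \<open>
  The change of the residuals caused by a change \<open>b\<close> of the products \<open>x s\<close>: the residual of index \<open>0\<close>
  contains \<open>- x \<bullet> s\<close>, so the sum of all residuals does not change.
\<close>
definition zero_sum_lift :: "real ^ 'n \<Rightarrow> real ^ 'n option" where
  "zero_sum_lift b = (\<chi> j. case j of None \<Rightarrow> - (\<Sum>i\<in>UNIV. b $ i) | Some i \<Rightarrow> b $ i)"

lemma zero_sum_lift_simps [simp]:
  "zero_sum_lift b $ None = - (\<Sum>i\<in>UNIV. b $ i)" "zero_sum_lift b $ Some i = b $ i"
  by (simp_all add: zero_sum_lift_def)

lemma sum_option: "(\<Sum>j\<in>UNIV. f j) = f None + (\<Sum>i\<in>UNIV. f (Some i))"
  for f :: "'n::finite option \<Rightarrow> 'b::comm_monoid_add"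
  by (simp add: UNIV_option_conv sum.reindex)

lemma sum_zero_sum_lift [simp]: "(\<Sum>j\<in>UNIV. zero_sum_lift b $ j) = 0"
  by (simp add: sum_option)

lemma vec_eq_option:
  fixes a b :: "real ^ 'n::finite option"
  assumes "\<And>i. a $ Some i = b $ Some i" "(\<Sum>j\<in>UNIV. a $ j) = (\<Sum>j\<in>UNIV. b $ j)"
  shows "a = b"
proof -
  have "a $ None = b $ None" using assms(2) by (simp add: sum_option assms(1))
  then show ?thesis using assms(1) by (metis not_None_eq vec_eq_iff)
qed

text \<open>
  The scaled vectors \<open>\<surd>(s/x) \<Delta>x\<close> and \<open>\<surd>(x/s) \<Delta>s\<close> have sum \<open>a / \<surd>(x s)\<close> and nonnegative inner
  product. By the inequality of arithmetic and geometric means, the positive components of \<open>\<Delta>x \<Delta>s\<close>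
  have a sum \<open>P\<close> of at most a quarter of the right-hand side, and by monotonicity the negative ones
  have a sum of absolute value \<open>N \<le> P\<close>. The squared norm on the left is then at most
  \<open>(P - N)\<^sup>2 + P\<^sup>2 + N\<^sup>2 \<le> 2 P\<^sup>2\<close>.
\<close>
lemma norm_lift_product_le:
  fixes x s dx ds a :: "real ^ 'n"
  assumes pos: "\<And>i. 0 < x $ i" "\<And>i. 0 < s $ i"
    and eq: "s * dx + x * ds = a" and mono: "0 \<le> dx \<bullet> ds"
  shows "2 * sqrt 2 * norm (zero_sum_lift (dx * ds)) \<le> (\<Sum>i\<in>UNIV. (a $ i)\<^sup>2 / (x $ i * s $ i))"
proof -
  define b where "b = dx * ds"
  define A where "A = (\<Sum>i\<in>UNIV. (a $ i)\<^sup>2 / (x $ i * s $ i))"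
  define P where "P = (\<Sum>i\<in>UNIV. max (b $ i) 0)"
  define N where "N = (\<Sum>i\<in>UNIV. max (- b $ i) 0)"
  have b_le: "b $ i \<le> (a $ i)\<^sup>2 / (x $ i * s $ i) / 4" for i
  proof -
    have "a $ i = s $ i * dx $ i + x $ i * ds $ i" using eq by auto
    then have "(a $ i)\<^sup>2 - 4 * (x $ i * s $ i) * b $ i = (s $ i * dx $ i - x $ i * ds $ i)\<^sup>2"
      by (simp add: b_def algebra_simps power2_eq_square)
    then have "4 * (x $ i * s $ i) * b $ i \<le> (a $ i)\<^sup>2"
      by (metis diff_ge_0_iff_ge zero_le_power2)
    then show ?thesis using pos[of i] by (simp add: field_simps)
  qed
  have "P \<le> (\<Sum>i\<in>UNIV. (a $ i)\<^sup>2 / (x $ i * s $ i) / 4)"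
    unfolding P_def using b_le pos by (intro sum_mono) (simp add: less_imp_le)
  then have P: "P \<le> A / 4" by (simp add: A_def sum_divide_distrib)
  have "(\<Sum>i\<in>UNIV. b $ i) = P - N"
    unfolding P_def N_def sum_subtractf[symmetric] by (intro sum.cong) auto
  moreover have "0 \<le> (\<Sum>i\<in>UNIV. b $ i)" using mono by (simp add: inner_vec_def b_def)
  ultimately have PN: "(\<Sum>i\<in>UNIV. b $ i) = P - N" "N \<le> P" by auto
  have N0: "0 \<le> N" unfolding N_def by (intro sum_nonneg) auto
  have sq: "(\<Sum>i\<in>UNIV. (f i)\<^sup>2) \<le> (\<Sum>i\<in>UNIV. f i)\<^sup>2"
    if "\<And>i::'n. 0 \<le> f i" for f :: "'n \<Rightarrow> real"
  proof -
    have "f i * f i \<le> f i * (\<Sum>i\<in>UNIV. f i)" for i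
      using that by (intro mult_left_mono member_le_sum) auto
    then show ?thesis
      by (simp add: power2_eq_square sum_distrib_right sum_mono)
  qed
  have "(\<Sum>i\<in>UNIV. (b $ i)\<^sup>2) = (\<Sum>i\<in>UNIV. (max (b $ i) 0)\<^sup>2) + (\<Sum>i\<in>UNIV. (max (- b $ i) 0)\<^sup>2)"
    unfolding sum.distrib[symmetric] by (intro sum.cong) (auto simp: max_def)
  also have "\<dots> \<le> P\<^sup>2 + N\<^sup>2"
    unfolding P_def N_def by (intro add_mono sq) auto
  finally have bb: "(\<Sum>i\<in>UNIV. (b $ i)\<^sup>2) \<le> P\<^sup>2 + N\<^sup>2" .
  have "(norm (zero_sum_lift b))\<^sup>2 = (P - N)\<^sup>2 + (\<Sum>i\<in>UNIV. (b $ i)\<^sup>2)"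
    unfolding norm_square_sum sum_option by (simp add: PN(1) power2_commute)
  also have "\<dots> \<le> 2 * P\<^sup>2 - 2 * (N * (P - N))"
    using bb by (simp add: power2_eq_square algebra_simps)
  also have "\<dots> \<le> 2 * P\<^sup>2" using N0 PN(2) by simp
  finally have "(2 * sqrt 2 * norm (zero_sum_lift b))\<^sup>2 \<le> (4 * P)\<^sup>2"
    by (simp add: power_mult_distrib)
  then have "2 * sqrt 2 * norm (zero_sum_lift b) \<le> 4 * P"
    by (rule power2_le_imp_le) (use N0 PN(2) in simp)
  also have "\<dots> \<le> A" using P by simp
  finally show ?thesis by (simp add: b_def A_def)
qed

section \<open>The neighbourhoods in terms of scaled residuals\<close>

definition scaled_res :: "'n::finite point \<Rightarrow> real ^ 'n option" where
  "scaled_res z = (\<chi> j. res z $ j / rho (snd (snd z)))"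

lemma power2_index [simp]: "((v :: real ^ 'n)\<^sup>2) $ i = (v $ i)\<^sup>2"
  by (simp add: power2_eq_square)

lemma res_simps [simp]:
  "res (x, s, (v0, v)) $ None = v0 - x \<bullet> s"
  "res (x, s, (v0, v)) $ Some i = x $ i * s $ i - (v $ i)\<^sup>2"
  by simp_all

declare res.simps [simp del]

lemma feas_z_iff:
  "(x, s, (v0, v)) \<in> feas_z M q \<longleftrightarrow>
     - (M *v x) + s = q \<and> (\<forall>i. 0 < x $ i) \<and> (\<forall>i. 0 < s $ i) \<and> (norm v)\<^sup>2 < v0 \<and>
     (\<forall>j. 0 < res (x, s, (v0, v)) $ j)"
  by (auto simp: feas_z_def feas_pos_def feas_def feas_w_def less_imp_le split_option_all)

lemma rho_pos: "(norm v)\<^sup>2 < v0 \<Longrightarrow> 0 < rho (v0, v)"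
  by (simp add: divide_pos_pos)

lemma sum_res:
  "(\<Sum>j\<in>UNIV. res (x, s, (v0, v :: real ^ 'n)) $ j) = (real CARD('n) + 1) * rho (v0, v)"
  by (simp add: sum_option sum_subtractf inner_vec_def norm_square_sum)

lemma sum_scaled_res:
  assumes "rho (v0, v) \<noteq> 0"
  shows "(\<Sum>j\<in>UNIV. scaled_res (x, s, (v0, v :: real ^ 'n)) $ j - 1) = 0"
  using assms sum_res[of x s v0 v]
  by (simp add: sum_subtractf scaled_res_def sum_divide_distrib[symmetric] del: rho.simps)

lemma rhat_squared:
  assumes "0 < rho w" "0 < res (x, s, w) $ j"
  shows "(rhat (x, s, w) $ j)\<^sup>2 = scaled_res (x, s, w) $ j"
    and "0 < rhat (x, s, w) $ j"
  using assms by (simp_all add: scaled_res_def)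

lemma Psi_eq:
  assumes "0 < rho w" "\<And>j. 0 < res (x, s, w) $ j"
  shows "Psi (x, s, w) = - (\<Sum>j\<in>UNIV. ln (scaled_res (x, s, w) $ j))"
  unfolding Psi_def using rhat_squared(1)[OF assms(1) assms(2)] by (simp del: rhat.simps)

lemma zeta1_eq:
  assumes "0 < rho w" "\<And>j. 0 < res (x, s, w) $ j"
  shows "zeta1 (x, s, w) = norm (\<chi> j. 1 / scaled_res (x, s, w) $ j - 1)"
proof -
  have "(\<chi> j. 1 / (rhat (x, s, w) $ j)\<^sup>2) - 1 = (\<chi> j. 1 / scaled_res (x, s, w) $ j - 1)"
    using rhat_squared(1)[OF assms(1) assms(2)] by (simp add: vec_eq_iff del: rhat.simps)
  then show ?thesis by (simp add: zeta1_def del: rhat.simps)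
qed

lemma zeta0_squared_eq:
  fixes w :: "'n::finite par"
  assumes "0 < rho w" "\<And>j. 0 < res (x, s, w) $ j"
  shows "(zeta0 (x, s, w))\<^sup>2 = (\<Sum>j\<in>UNIV. 1 / scaled_res (x, s, w) $ j - 1)"
proof -
  obtain v0 v where w: "w = (v0, v)" by fastforce
  let ?u = "scaled_res (x, s, w)"
  have "((rhat (x, s, w) - (\<chi> j. 1 / rhat (x, s, w) $ j)) $ j)\<^sup>2 = (1 / ?u $ j - 1) + (?u $ j - 1)"
    for j
  proof -
    have "(rhat (x, s, w) $ j - 1 / rhat (x, s, w) $ j)\<^sup>2
        = 1 / (rhat (x, s, w) $ j)\<^sup>2 - 1 + ((rhat (x, s, w) $ j)\<^sup>2 - 1)"
      using rhat_squared(2)[OF assms(1) assms(2)[of j]]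
      by (simp add: field_simps power2_eq_square del: rhat.simps)
    then show ?thesis
      using rhat_squared(1)[OF assms(1) assms(2)[of j]] by (simp del: rhat.simps)
  qed
  then have "(zeta0 (x, s, w))\<^sup>2 = (\<Sum>j\<in>UNIV. 1 / ?u $ j - 1) + (\<Sum>j\<in>UNIV. ?u $ j - 1)"
    by (simp only: zeta0_def norm_square_sum sum.distrib)
  then show ?thesis using sum_scaled_res[of v0 v x s] assms(1) w by (simp del: rho.simps)
qed

lemma N_prox_bounds:
  fixes x s :: "real ^ 'n"
  assumes z: "(x, s, w) \<in> N_prox M q \<beta>" and b: "0 < \<beta>" "\<beta> < 1"
  shows "1 - \<beta> \<le> scaled_res (x, s, w) $ j"
    and "norm (scaled_res (x, s, w) - 1) \<le> \<beta> / (1 - \<beta>)"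
proof -
  obtain v0 v where w: "w = (v0, v)" by fastforce
  let ?u = "scaled_res (x, s, w)"
  have pos: "0 < rho w" "0 < res (x, s, w) $ j" for j
    using z by (auto simp: N_prox_def w feas_z_iff rho_pos simp del: rho.simps)
  have u_pos: "0 < ?u $ j" for j using pos by (simp add: scaled_res_def)
  have prox: "prox (x, s, w) \<le> \<beta>" using z by (simp add: N_prox_def)
  have "(zeta0 (x, s, w))\<^sup>2 \<le> \<beta> * zeta1 (x, s, w)"
  proof (cases "zeta1 (x, s, w) = 0")
    case True
    then have "(\<chi> j. 1 / ?u $ j - 1) = 0" by (simp add: zeta1_eq[OF pos])
    then have "1 / ?u $ j - 1 = 0" for j by (simp add: vec_eq_iff)
    then have "(\<Sum>j\<in>UNIV. 1 / ?u $ j - 1) = 0" by (intro sum.neutral) blast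
    then show ?thesis by (simp add: True zeta0_squared_eq[OF pos])
  next
    case False
    then have "0 < zeta1 (x, s, w)" by (simp add: zeta1_def)
    then show ?thesis using prox False by (simp add: prox_def pos_divide_le_eq)
  qed
  then have "(\<Sum>j\<in>UNIV. 1 / ?u $ j - 1) \<le> \<beta> * norm (\<chi> j. 1 / ?u $ j - 1)"
    by (simp add: zeta0_squared_eq[OF pos] zeta1_eq[OF pos])
  moreover have "(\<Sum>j\<in>UNIV. ?u $ j - 1) = 0"
    using sum_scaled_res[of v0 v x s] pos(1) w by (simp del: rho.simps)
  ultimately show "1 - \<beta> \<le> ?u $ j" "norm (?u - 1) \<le> \<beta> / (1 - \<beta>)"
    using centrality_bounds[OF b u_pos] by blast+
qed

section \<open>Search directions\<close>

lemma direction_monotone: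
  assumes "pos_semidef M" "is_direction M (x, s, w) a dx ds"
  shows "0 \<le> dx \<bullet> ds"
proof -
  have "ds = M *v dx" using assms(2) by simp
  then show ?thesis using assms(1) by (simp add: pos_semidef_def)
qed

text \<open>
  Eliminating \<open>\<Delta>s\<close> leaves the square system \<open>s d + x (M d) = a\<close>. It is injective: if \<open>a = 0\<close>, then
  \<open>M d = - (s / x) d\<close>, and \<open>d \<bullet> M d \<ge> 0\<close> forces \<open>d = 0\<close>.
\<close>
lemma direction_exists:
  fixes x s a :: "real ^ 'n"
  assumes M: "pos_semidef M" and pos: "\<And>i. 0 < x $ i" "\<And>i. 0 < s $ i"
  shows "\<exists>dx ds. is_direction M (x, s, w) a dx ds"
proof -
  let ?f = "\<lambda>d. s * d + x * (M *v d)"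
  have lin: "linear ?f"
    by (rule linearI)
      (simp_all add: matrix_vector_right_distrib matrix_vector_mult_scaleR vec_eq_iff algebra_simps)
  have "d = 0" if "?f d = 0" for d
  proof -
    have eq: "(M *v d) $ i = - (s $ i / x $ i * d $ i)" for i
    proof -
      have "s $ i * d $ i + x $ i * (M *v d) $ i = 0"
        using that by (simp add: vec_eq_iff)
      then show ?thesis using pos(1)[of i] by (simp add: field_simps)
    qed
    have "(\<Sum>i\<in>UNIV. s $ i / x $ i * (d $ i)\<^sup>2) = - (d \<bullet> (M *v d))"
      unfolding inner_vec_def sum_negf[symmetric]
      by (intro sum.cong) (simp_all add: eq power2_eq_square)
    also have "\<dots> \<le> 0" using M by (simp add: pos_semidef_def)
    finally have le: "(\<Sum>i\<in>UNIV. s $ i / x $ i * (d $ i)\<^sup>2) \<le> 0" .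
    have nn: "0 \<le> s $ i / x $ i * (d $ i)\<^sup>2" for i
      using pos by (simp add: less_imp_le)
    have "(\<Sum>i\<in>UNIV. s $ i / x $ i * (d $ i)\<^sup>2) = 0"
      by (intro antisym le sum_nonneg nn)
    then have "\<forall>i\<in>UNIV. s $ i / x $ i * (d $ i)\<^sup>2 = 0"
      using nn by (subst (asm) sum_nonneg_eq_0_iff) auto
    then have z: "s $ i / x $ i * (d $ i)\<^sup>2 = 0" for i by (rule bspec) simp
    have "d $ i = 0" for i
    proof -
      have "s $ i / x $ i \<noteq> 0" using pos(1)[of i] pos(2)[of i] by simp
      then show "d $ i = 0" using z[of i] unfolding mult_eq_0_iff power_eq_0_iff by blast
    qed
    then show "d = 0" by (simp add: vec_eq_iff)
  qed
  then have "inj ?f" using linear_injective_0[OF lin] by blast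
  then have "surj ?f" by (intro linear_injective_imp_surjective[OF lin] refl)
  then have "a \<in> range ?f" by simp
  then obtain d where "a = ?f d" by (rule rangeE)
  then have "is_direction M (x, s, w) a d (M *v d)" by simp
  then show ?thesis by blast
qed

text \<open>
  It gives positivity of the new \<open>x\<close> and \<open>s\<close> from data at the end of a step: a positive
  product excludes opposite signs, and the linearised product, which is known exactly, excludes two
  negative ones.
\<close>
lemma both_pos_if_product_and_weighted_sum_pos:
  fixes x s x' s' :: real
  assumes "0 < x" "0 < s" "0 < x' * s'" "0 < s * x' + x * s'"
  shows "0 < x' \<and> 0 < s'"
proof -
  have "\<not> (x' < 0 \<and> s' < 0)"
    using assms(4) mult_pos_neg[OF assms(2), of x'] mult_pos_neg[OF assms(1), of s'] by auto
  then show ?thesis using assms(3) by (auto simp: zero_less_mult_iff)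
qed

section \<open>The predictor step\<close>

text \<open>
  The orthogonal projection of \<open>(0, v\<^sup>2)\<close> onto the vectors with zero sum.
\<close>
definition centred_squares :: "real ^ 'n \<Rightarrow> real ^ 'n option" where
  "centred_squares v =
     (\<chi> j. (case j of None \<Rightarrow> 0 | Some i \<Rightarrow> (v $ i)\<^sup>2) - (norm v)\<^sup>2 / (real CARD('n) + 1))"

lemma norm_centred_squares: "norm (centred_squares (v :: real ^ 'n)) \<le> (norm v)\<^sup>2"
proof -
  define V where "V = (norm v)\<^sup>2"
  define N where "N = real CARD('n) + 1"
  have N: "N > 0" by (simp add: N_def)
  have n: "real CARD('n) = N - 1" by (simp add: N_def)
  have V: "(\<Sum>i\<in>UNIV. (v $ i)\<^sup>2) = V" by (simp add: V_def norm_square_sum)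
  have "((v $ i)\<^sup>2 - V / N)\<^sup>2 = ((v $ i)\<^sup>2)\<^sup>2 - (2 * V / N) * (v $ i)\<^sup>2 + (V / N)\<^sup>2" for i
    by (simp add: power2_diff)
  then have "(\<Sum>i\<in>UNIV. ((v $ i)\<^sup>2 - V / N)\<^sup>2)
      = (\<Sum>i\<in>UNIV. ((v $ i)\<^sup>2)\<^sup>2) - (2 * V / N) * V + (N - 1) * (V / N)\<^sup>2"
    by (simp only: sum.distrib sum_subtractf sum_distrib_left[symmetric] V sum_constant n)
  moreover have "(norm (centred_squares v))\<^sup>2 = (V / N)\<^sup>2 + (\<Sum>i\<in>UNIV. ((v $ i)\<^sup>2 - V / N)\<^sup>2)"
    unfolding norm_square_sum sum_option by (simp add: centred_squares_def V_def N_def)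
  ultimately have "(norm (centred_squares v))\<^sup>2
      = (\<Sum>i\<in>UNIV. ((v $ i)\<^sup>2)\<^sup>2) + ((V / N)\<^sup>2 - (2 * V / N) * V + (N - 1) * (V / N)\<^sup>2)"
    by linarith
  also have "(V / N)\<^sup>2 - (2 * V / N) * V + (N - 1) * (V / N)\<^sup>2 = - (V\<^sup>2 / N)"
    using N by (simp add: field_simps power2_eq_square)
  finally have "(norm (centred_squares v))\<^sup>2 = (\<Sum>i\<in>UNIV. ((v $ i)\<^sup>2)\<^sup>2) - V\<^sup>2 / N"
    by simp
  also have "\<dots> \<le> (\<Sum>i\<in>UNIV. ((v $ i)\<^sup>2)\<^sup>2)" using N by simp
  also have "\<dots> \<le> (\<Sum>i\<in>UNIV. V * (v $ i)\<^sup>2)"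
  proof (rule sum_mono)
    fix i
    have "(v $ i)\<^sup>2 \<le> V" unfolding V[symmetric] by (rule member_le_sum) auto
    then show "((v $ i)\<^sup>2)\<^sup>2 \<le> V * (v $ i)\<^sup>2"
      unfolding power2_eq_square[of "(v $ i)\<^sup>2"] by (rule mult_right_mono) simp
  qed
  also have "\<dots> = V\<^sup>2" by (simp only: sum_distrib_left[symmetric] V) (simp add: power2_eq_square)
  finally show ?thesis
    unfolding V_def[symmetric] by (rule power2_le_imp_le) (simp add: V_def)
qed

lemma rho_shrink:
  fixes v :: "real ^ 'n"
  shows "rho ((1 - \<alpha>) *\<^sub>R (v0, v))
    = (1 - \<alpha>) * (rho (v0, v) + \<alpha> * ((norm v)\<^sup>2 / (real CARD('n) + 1)))"
proof -
  define V where "V = (norm v)\<^sup>2"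
  have "(norm ((1 - \<alpha>) *\<^sub>R v))\<^sup>2 = (1 - \<alpha>)\<^sup>2 * V" by (simp add: V_def power_mult_distrib)
  then have "rho ((1 - \<alpha>) *\<^sub>R (v0, v)) = ((1 - \<alpha>) * v0 - (1 - \<alpha>)\<^sup>2 * V) / (real CARD('n) + 1)"
    by simp
  also have "(1 - \<alpha>) * v0 - (1 - \<alpha>)\<^sup>2 * V = (1 - \<alpha>) * ((v0 - V) + \<alpha> * V)"
    by (simp add: power2_eq_square algebra_simps)
  also have "(1 - \<alpha>) * ((v0 - V) + \<alpha> * V) / (real CARD('n) + 1)
      = (1 - \<alpha>) * ((v0 - V) / (real CARD('n) + 1) + \<alpha> * (V / (real CARD('n) + 1)))"
    unfolding add_divide_distrib[symmetric] times_divide_eq_right by (rule refl)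
  finally show ?thesis by (simp only: V_def rho.simps)
qed

text \<open>
  The first-order terms cancel up to the factor \<open>1 - \<theta> * \<alpha>\<close>: the part \<open>\<parallel>v\<parallel>\<^sup>2 / (n + 1) - \<rho>\<close> of the
  right-hand side is the derivative of \<open>\<rho>\<close> along the step, and the part \<open>- 2 v\<^sup>2\<close> compensates the
  shrinking of \<open>v\<^sup>2\<close>. It suffices to compare the components \<open>1, \<dots>, n\<close> and the sums.
\<close>
lemma res_pred_point:
  fixes x s v :: "real ^ 'n" and v0 :: real
  defines "z \<equiv> (x, s, (v0, v))"
  assumes dir: "is_direction M z (a_ut z + \<theta> *\<^sub>R a_c z) dx ds"
  shows "res (pred_point z dx ds \<alpha>) =
    rho ((1 - \<alpha>) *\<^sub>R (v0, v)) *\<^sub>R 1 + (1 - \<theta> * \<alpha>) *\<^sub>R (res z - rho (v0, v) *\<^sub>R 1)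
      + \<alpha>\<^sup>2 *\<^sub>R (zero_sum_lift (dx * ds) - centred_squares v)" (is "?l = ?r")
proof (rule vec_eq_option)
  define W where "W = (norm v)\<^sup>2 / (real CARD('n) + 1)"
  define r where "r = rho (v0, v)"
  fix i
  have a: "s $ i * dx $ i + x $ i * ds $ i
      = W - r - 2 * (v $ i)\<^sup>2 + \<theta> * (r - x $ i * s $ i + (v $ i)\<^sup>2)"
  proof -
    have "(s * dx + x * ds) $ i = (a_ut z + \<theta> *\<^sub>R a_c z) $ i"
      using dir unfolding z_def is_direction.simps by (simp only:)
    then show ?thesis by (simp add: z_def W_def r_def del: rho.simps)
  qed
  have "(x $ i + \<alpha> * dx $ i) * (s $ i + \<alpha> * ds $ i)
      = x $ i * s $ i + \<alpha> * (s $ i * dx $ i + x $ i * ds $ i) + \<alpha>\<^sup>2 * (dx $ i * ds $ i)"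
    by (simp add: algebra_simps power2_eq_square)
  then have "?l $ Some i = x $ i * s $ i
      + \<alpha> * (W - r - 2 * (v $ i)\<^sup>2 + \<theta> * (r - x $ i * s $ i + (v $ i)\<^sup>2))
      + \<alpha>\<^sup>2 * (dx $ i * ds $ i) - ((1 - \<alpha>) * v $ i)\<^sup>2"
    unfolding a by (simp add: z_def)
  moreover have "?r $ Some i = (1 - \<alpha>) * (r + \<alpha> * W)
      + (1 - \<theta> * \<alpha>) * (x $ i * s $ i - (v $ i)\<^sup>2 - r)
      + \<alpha>\<^sup>2 * (dx $ i * ds $ i - ((v $ i)\<^sup>2 - W))"
    unfolding rho_shrink
    by (simp add: z_def r_def[symmetric] W_def[symmetric] centred_squares_def del: rho.simps)
  ultimately show "?l $ Some i = ?r $ Some i"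
    by (simp add: algebra_simps power2_eq_square)
next
  define W where "W = (norm v)\<^sup>2 / (real CARD('n) + 1)"
  have "(\<Sum>j\<in>UNIV. centred_squares v $ j) = (norm v)\<^sup>2 - (real CARD('n) + 1) * W"
    unfolding sum_option centred_squares_def W_def[symmetric]
    by (simp add: sum_subtractf norm_square_sum distrib_right)
  then have "(\<Sum>j\<in>UNIV. centred_squares v $ j) = 0" by (simp add: W_def)
  moreover have "(\<Sum>j\<in>UNIV. ?l $ j) = (real CARD('n) + 1) * rho ((1 - \<alpha>) *\<^sub>R (v0, v))"
    unfolding z_def pred_point.simps scaleR_Pair by (rule sum_res)
  moreover have "(\<Sum>j\<in>UNIV. res z $ j) = (real CARD('n) + 1) * rho (v0, v)"
    unfolding z_def by (rule sum_res)
  ultimately show "(\<Sum>j\<in>UNIV. ?l $ j) = (\<Sum>j\<in>UNIV. ?r $ j)"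
    by (simp add: sum.distrib sum_subtractf sum_distrib_left[symmetric] sum_distrib_right[symmetric]
        algebra_simps del: rho.simps scaleR_Pair)
qed

lemma feas_segment:
  assumes "- (M *v x) + s = q" "is_direction M (x, s, w) a dx ds"
  shows "- (M *v (x + \<alpha> *\<^sub>R dx)) + (s + \<alpha> *\<^sub>R ds) = q"
proof -
  have "ds = M *v dx" using assms(2) by simp
  then show ?thesis
    using assms(1)
    by (simp add: matrix_vector_right_distrib matrix_vector_mult_scaleR algebra_simps)
qed

text \<open>
  The contribution of one component to \<open>\<Sum> a\<^sub>i\<^sup>2 / (x\<^sub>i s\<^sub>i)\<close>, for \<open>a\<^sub>i = \<rho> (\<kappa> - \<nu> - 2 y)\<close> and
  \<open>x\<^sub>i s\<^sub>i = \<rho> (u + y)\<close> with \<open>y = v\<^sub>i\<^sup>2 / \<rho>\<close>; here \<open>\<nu> = 1\<close> belongs to the universal tangent and \<open>\<nu> = u\<close>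
  to the auto-corrector. Large \<open>y\<close> do no harm by the Cauchy inequality
  \<open>(c - 2 y)\<^sup>2 / (u + y) \<le> c\<^sup>2 / u + (2 y)\<^sup>2 / y\<close>.
\<close>
lemma scaled_step_bound:
  fixes \<rho> \<kappa> \<nu> u y :: real
  assumes "0 < \<rho>" "0 \<le> \<kappa>" "0 \<le> y" "3 / 4 \<le> u" "u \<le> 4 / 3" "\<nu> = 1 \<or> \<nu> = u"
  shows "(\<rho> * (\<kappa> - \<nu> - 2 * y))\<^sup>2 / (\<rho> * (u + y)) \<le> \<rho> * (4 / 3 * (\<kappa>\<^sup>2 + 1) - 2 * \<kappa>) + 4 * (\<rho> * y)"
proof -
  define c where "c = \<kappa> - \<nu>"
  have u: "0 < u" using assms by simp
  have "(c\<^sup>2 / u + 4 * y) * (u + y) - (c - 2 * y)\<^sup>2 = y * (c + 2 * u)\<^sup>2 / u"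
    using u by (simp add: field_simps power2_eq_square)
  moreover have "0 \<le> y * (c + 2 * u)\<^sup>2 / u" using u assms(3) by simp
  ultimately have "(c - 2 * y)\<^sup>2 \<le> (c\<^sup>2 / u + 4 * y) * (u + y)" by linarith
  then have "(c - 2 * y)\<^sup>2 / (u + y) \<le> c\<^sup>2 / u + 4 * y"
    using u assms(3) by (simp add: pos_divide_le_eq)
  moreover have "c\<^sup>2 / u \<le> 4 / 3 * (\<kappa>\<^sup>2 + 1) - 2 * \<kappa>"
  proof (cases "\<nu> = 1")
    case True
    have "1 / u \<le> 4 / 3" using assms(4) u by (simp add: pos_divide_le_eq)
    then have "c\<^sup>2 * (1 / u) \<le> c\<^sup>2 * (4 / 3)" by (rule mult_left_mono) simp
    also have "\<dots> \<le> 4 / 3 * (\<kappa>\<^sup>2 + 1) - 2 * \<kappa>"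
      using assms(2) by (simp add: c_def True power2_eq_square algebra_simps)
    finally show ?thesis by simp
  next
    case False
    have "1 / u \<le> 4 / 3" using assms(4) u by (simp add: pos_divide_le_eq)
    then have "\<kappa>\<^sup>2 * (1 / u) \<le> \<kappa>\<^sup>2 * (4 / 3)" by (rule mult_left_mono) simp
    moreover have "c = \<kappa> - u" using False assms(6) by (auto simp: c_def)
    then have "c\<^sup>2 / u = \<kappa>\<^sup>2 * (1 / u) - 2 * \<kappa> + u"
      using u by (simp add: power2_diff add_divide_distrib diff_divide_distrib)
        (simp add: power2_eq_square)
    ultimately show ?thesis using assms(5) by simp
  qed
  ultimately have "(c - 2 * y)\<^sup>2 / (u + y) \<le> 4 / 3 * (\<kappa>\<^sup>2 + 1) - 2 * \<kappa> + 4 * y" by linarith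
  then have "\<rho> * ((c - 2 * y)\<^sup>2 / (u + y)) \<le> \<rho> * (4 / 3 * (\<kappa>\<^sup>2 + 1) - 2 * \<kappa> + 4 * y)"
    using assms(1) by (intro mult_left_mono) auto
  moreover have "(\<rho> * (c - 2 * y))\<^sup>2 / (\<rho> * (u + y)) = \<rho> * ((c - 2 * y)\<^sup>2 / (u + y))"
    using assms(1) by (simp add: power2_eq_square)
  moreover have "\<rho> * (4 / 3 * (\<kappa>\<^sup>2 + 1) - 2 * \<kappa> + 4 * y)
      = \<rho> * (4 / 3 * (\<kappa>\<^sup>2 + 1) - 2 * \<kappa>) + 4 * (\<rho> * y)" by (simp only: distrib_left mult.left_commute)
  ultimately show ?thesis unfolding c_def by linarith
qed

text \<open>
  The ratio of \<open>\<parallel>v\<parallel>\<^sup>2 / (n + 1)\<close> to \<open>\<rho>\<close>. It governs the trade-off in the predictor: for large \<open>\<kappa>\<close> only steps of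
  size about \<open>1 / \<kappa>\<close> are admissible, but they reduce \<open>\<mu>\<^sup>*\<close> by the factor \<open>(1 - \<alpha>) / (1 + \<alpha> \<kappa>)\<close>.
\<close>
definition kappa :: "'n::finite par \<Rightarrow> real" where
  "kappa w = (norm (snd w))\<^sup>2 / (fst w - (norm (snd w))\<^sup>2)"

text \<open>
  Summing the componentwise bounds gives at most \<open>n \<rho> (4/3 (\<kappa>\<^sup>2 + 1) + 6 \<kappa>) \<le> 13/6 n \<rho> (1 + \<kappa>)\<^sup>2\<close>
  for \<open>\<Sum> a\<^sub>i\<^sup>2 / (x\<^sub>i s\<^sub>i)\<close>, where \<open>\<parallel>v\<parallel>\<^sup>2 = (n + 1) \<rho> \<kappa> \<le> 2 n \<rho> \<kappa>\<close>. This makes the norm of the lifted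
  product at most \<open>0.78 n \<rho> (1 + \<kappa>)\<^sup>2\<close>, and \<open>\<parallel>v\<parallel>\<^sup>2\<close> adds at most \<open>0.5 n \<rho> (1 + \<kappa>)\<^sup>2\<close>. The second claim
  keeps the linearised products \<open>2 x s + \<alpha> a\<close> positive for \<open>\<alpha> \<le> 1\<close>.
\<close>
lemma predictor_second_order_bound:
  fixes x s v :: "real ^ 'n" and v0 :: real
  defines "z \<equiv> (x, s, (v0, v))"
  assumes M: "pos_semidef M" and z: "z \<in> N_prox M q (1 / 4)" and \<theta>: "\<theta> = 0 \<or> \<theta> = 1"
    and dir: "is_direction M z (a_ut z + \<theta> *\<^sub>R a_c z) dx ds"
  shows "norm (zero_sum_lift (dx * ds) - centred_squares v)
    \<le> 32 / 25 * (real CARD('n) * rho (v0, v) * (1 + kappa (v0, v))\<^sup>2)"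
    and "- 2 * (x $ i * s $ i) < (a_ut z + \<theta> *\<^sub>R a_c z) $ i"
proof -
  define n where "n = real CARD('n)"
  define \<rho> where "\<rho> = rho (v0, v)"
  define \<kappa> where "\<kappa> = kappa (v0, v)"
  define V where "V = (norm v)\<^sup>2"
  define a where "a = a_ut z + \<theta> *\<^sub>R a_c z"
  define u where "u = (\<lambda>i. scaled_res z $ Some i)"
  define y where "y = (\<lambda>i. (v $ i)\<^sup>2 / \<rho>)"
  define \<nu> where "\<nu> = (\<lambda>i. if \<theta> = 0 then 1 else u i)"
  have F: "z \<in> feas_z M q" using z by (simp add: N_prox_def)
  have pos: "0 < x $ i" "0 < s $ i" for i using F by (auto simp: z_def feas_z_iff)
  have V: "V < v0" using F by (auto simp: z_def V_def feas_z_iff)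
  have \<rho>: "0 < \<rho>" using V by (simp add: \<rho>_def V_def rho_pos del: rho.simps)
  have n: "1 \<le> n" by (simp add: n_def Suc_le_eq)
  have \<kappa>0: "0 \<le> \<kappa>" using V by (simp add: \<kappa>_def kappa_def V_def)
  have "(n + 1) * \<rho> = v0 - V" using n by (simp add: \<rho>_def n_def V_def)
  moreover have "\<kappa> * (v0 - V) = V" using V by (simp add: \<kappa>_def kappa_def V_def)
  ultimately have V\<kappa>: "V = (n + 1) * \<rho> * \<kappa>" by (simp add: mult_ac)
  have u_lo: "3 / 4 \<le> u i" for i
    using N_prox_bounds(1)[of x s "(v0, v)" M q "1 / 4" "Some i"] z by (simp add: u_def z_def)
  have "norm (scaled_res z - 1) \<le> 1 / 3"
    using N_prox_bounds(2)[of x s "(v0, v)" M q "1 / 4"] z by (simp add: z_def)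
  then have u_hi: "u i \<le> 4 / 3" for i
    using component_le_norm_cart[of "scaled_res z - 1" "Some i"] by (simp add: u_def)
  have y0: "0 \<le> y i" for i using \<rho> by (simp add: y_def)
  have xs: "x $ i * s $ i = \<rho> * (u i + y i)" for i
    using \<rho> by (simp add: u_def y_def scaled_res_def z_def \<rho>_def[symmetric] field_simps del: rho.simps)
  have vi: "(v $ i)\<^sup>2 = \<rho> * y i" for i using \<rho> by (simp add: y_def)
  have W: "V / (n + 1) = \<rho> * \<kappa>" using n by (simp add: V\<kappa> field_simps)
  have a_eq: "a $ i = \<rho> * (\<kappa> - \<nu> i - 2 * y i)" for i
  proof -
    have "a $ i = (V / (n + 1) - \<rho>) - 2 * (v $ i)\<^sup>2 + \<theta> * (\<rho> - x $ i * s $ i + (v $ i)\<^sup>2)"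
      by (simp add: a_def z_def V_def n_def \<rho>_def del: rho.simps)
    then show ?thesis
      using \<theta> unfolding W xs vi by (auto simp: \<nu>_def algebra_simps)
  qed
  define A where "A = (\<Sum>i\<in>UNIV. (a $ i)\<^sup>2 / (x $ i * s $ i))"
  have "A \<le> (\<Sum>i\<in>(UNIV :: 'n set). \<rho> * (4 / 3 * (\<kappa>\<^sup>2 + 1) - 2 * \<kappa>) + 4 * (\<rho> * y i))"
    unfolding A_def a_eq xs
    by (intro sum_mono scaled_step_bound \<rho> \<kappa>0 y0 u_lo u_hi) (auto simp: \<nu>_def)
  also have "\<dots> = n * (\<rho> * (4 / 3 * (\<kappa>\<^sup>2 + 1) - 2 * \<kappa>)) + 4 * V"
    unfolding vi[symmetric] sum.distrib sum_distrib_left[symmetric] norm_square_sum[symmetric] V_def[symmetric]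
    by (simp add: n_def)
  also have V_le: "V \<le> n * \<rho> * (2 * \<kappa>)"
  proof -
    have "(n + 1) * (\<rho> * \<kappa>) \<le> (2 * n) * (\<rho> * \<kappa>)"
      using n \<rho> \<kappa>0 by (intro mult_right_mono) auto
    then show ?thesis by (simp add: V\<kappa> mult_ac)
  qed
  finally have "A \<le> n * \<rho> * (4 / 3 * (\<kappa>\<^sup>2 + 1) + 6 * \<kappa>)" by (simp add: algebra_simps)
  also have "\<dots> \<le> n * \<rho> * (13 / 6 * (1 + \<kappa>)\<^sup>2)"
  proof (rule mult_left_mono)
    have "13 / 6 * (1 + \<kappa>)\<^sup>2 - (4 / 3 * (\<kappa>\<^sup>2 + 1) + 6 * \<kappa>) = 5 / 6 * (\<kappa> - 1)\<^sup>2"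
      unfolding power2_sum power2_diff by (simp add: field_simps)
    then show "4 / 3 * (\<kappa>\<^sup>2 + 1) + 6 * \<kappa> \<le> 13 / 6 * (1 + \<kappa>)\<^sup>2"
      using zero_le_power2[of "\<kappa> - 1"] by linarith
  qed (use n \<rho> in auto)
  finally have A: "A \<le> 13 / 6 * (n * \<rho> * (1 + \<kappa>)\<^sup>2)" by simp
  have K: "0 \<le> n * \<rho> * (1 + \<kappa>)\<^sup>2" using n \<rho> by simp
  have "s * dx + x * ds = a" using dir unfolding a_def z_def is_direction.simps by blast
  moreover have "0 \<le> dx \<bullet> ds" using direction_monotone[OF M] dir unfolding z_def by blast
  ultimately have "2 * sqrt 2 * norm (zero_sum_lift (dx * ds)) \<le> A"
    unfolding A_def by (intro norm_lift_product_le pos)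
  moreover have "14 / 5 * norm (zero_sum_lift (dx * ds)) \<le> 2 * sqrt 2 * norm (zero_sum_lift (dx * ds))"
  proof (rule mult_right_mono)
    have "7 / 5 \<le> sqrt 2" by (rule real_le_rsqrt) (simp add: power2_eq_square)
    then show "14 / 5 \<le> 2 * sqrt 2" by simp
  qed simp
  ultimately have lift_le: "norm (zero_sum_lift (dx * ds)) \<le> 39 / 50 * (n * \<rho> * (1 + \<kappa>)\<^sup>2)"
    using A K by linarith
  have "2 * \<kappa> \<le> (1 + \<kappa>)\<^sup>2 / 2"
    using zero_le_power2[of "\<kappa> - 1"] by (simp add: power2_eq_square algebra_simps)
  then have "n * \<rho> * (2 * \<kappa>) \<le> n * \<rho> * ((1 + \<kappa>)\<^sup>2 / 2)" using n \<rho> by (intro mult_left_mono) auto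
  then have "norm (centred_squares v) \<le> 1 / 2 * (n * \<rho> * (1 + \<kappa>)\<^sup>2)"
    using V_le norm_centred_squares[of v] by (simp add: V_def)
  then show "norm (zero_sum_lift (dx * ds) - centred_squares v) \<le> 32 / 25 * (n * \<rho> * (1 + \<kappa>)\<^sup>2)"
    using lift_le norm_triangle_ineq4[of "zero_sum_lift (dx * ds)" "centred_squares v"] by linarith
  have "\<nu> i < 2 * u i" using u_lo[of i] by (simp add: \<nu>_def)
  then have "0 < \<rho> * (\<kappa> - \<nu> i + 2 * u i)" using \<kappa>0 by (intro mult_pos_pos \<rho>) simp
  then show "- 2 * (x $ i * s $ i) < a $ i" unfolding a_eq xs by (simp add: algebra_simps)
qed


lemma feas_z_step:
  fixes x s :: "real ^ 'n"
  assumes feas: "- (M *v x) + s = q" and pos: "\<And>i. 0 < x $ i" "\<And>i. 0 < s $ i"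
    and dir: "is_direction M (x, s, w) a dx ds"
    and \<alpha>: "0 \<le> \<alpha>" "\<alpha> \<le> 1"
    and a: "\<And>i. - 2 * (x $ i * s $ i) < a $ i"
    and v: "(norm v)\<^sup>2 < v0"
    and res: "\<And>j. 0 < res (x + \<alpha> *\<^sub>R dx, s + \<alpha> *\<^sub>R ds, (v0, v)) $ j"
  shows "(x + \<alpha> *\<^sub>R dx, s + \<alpha> *\<^sub>R ds, (v0, v)) \<in> feas_z M q"
proof -
  have "0 < (x + \<alpha> *\<^sub>R dx) $ i \<and> 0 < (s + \<alpha> *\<^sub>R ds) $ i" for i
  proof (rule both_pos_if_product_and_weighted_sum_pos[OF pos])
    have "0 \<le> (v $ i)\<^sup>2" by simp
    then show "0 < (x + \<alpha> *\<^sub>R dx) $ i * (s + \<alpha> *\<^sub>R ds) $ i"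
      using res[of "Some i"] by (simp only: res_simps)
    have "(s * dx + x * ds) $ i = a $ i" using dir by (simp only: is_direction.simps)
    then have a_i: "a $ i = s $ i * dx $ i + x $ i * ds $ i" by simp
    have "s $ i * (x + \<alpha> *\<^sub>R dx) $ i + x $ i * (s + \<alpha> *\<^sub>R ds) $ i
        = (1 - \<alpha>) * (2 * (x $ i * s $ i)) + \<alpha> * (2 * (x $ i * s $ i) + a $ i)"
      unfolding a_i by (simp add: algebra_simps)
    moreover have "0 < (1 - \<alpha>) * (2 * (x $ i * s $ i)) + \<alpha> * (2 * (x $ i * s $ i) + a $ i)"
    proof (cases "\<alpha> = 0")
      case False
      have "0 < \<alpha> * (2 * (x $ i * s $ i) + a $ i)"
        using False \<alpha> a[of i] by (intro mult_pos_pos) auto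
      moreover have "0 \<le> (1 - \<alpha>) * (2 * (x $ i * s $ i))"
        using \<alpha> pos[of i] by (intro mult_nonneg_nonneg) (auto simp: less_imp_le)
      ultimately show ?thesis by linarith
    qed (use pos[of i] in simp)
    ultimately show "0 < s $ i * (x + \<alpha> *\<^sub>R dx) $ i + x $ i * (s + \<alpha> *\<^sub>R ds) $ i" by linarith
  qed
  then show ?thesis
    using feas_segment[OF feas dir] v res by (simp only: feas_z_iff) blast
qed

text \<open>
  Let \<open>D\<close> be the deviation of the new scaled residuals from \<open>1\<close> and \<open>\<rho>'\<close> the new value of \<open>\<rho>\<close>. The old
  deviation has norm at most \<open>1/3\<close>, and the second-order term contributes at most
  \<open>32/25 (5/16)\<^sup>2 \<rho> = \<rho> / 8\<close>, so \<open>\<rho>' \<parallel>D\<parallel> \<le> 11/24 \<rho>\<close>. As \<open>\<alpha> \<le> 5/16\<close>, also \<open>\<rho>' \<ge> 11/16 \<rho>\<close>, and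
  \<open>\<parallel>D\<parallel> \<le> 2/3\<close> follows. In particular no residual vanishes, which gives feasibility.
\<close>
lemma predictor_step_admissible:
  fixes x s v dx ds :: "real ^ 'n" and v0 :: real
  defines "z \<equiv> (x, s, (v0, v))"
  assumes M: "pos_semidef M" and z: "z \<in> N_prox M q (1 / 4)" and \<theta>: "\<theta> = 0 \<or> \<theta> = 1"
    and dir: "is_direction M z (a_ut z + \<theta> *\<^sub>R a_c z) dx ds"
    and \<alpha>: "0 \<le> \<alpha>" "\<alpha> * (1 + kappa (v0, v)) * sqrt (real CARD('n)) \<le> 5 / 16"
  shows "pred_point z dx ds \<alpha> \<in> N_Psi M q (omega_star (2 / 3))"
proof -
  define n where "n = real CARD('n)"
  define \<rho> where "\<rho> = rho (v0, v)"
  define \<rho>' where "\<rho>' = rho ((1 - \<alpha>) *\<^sub>R (v0, v))"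
  define \<kappa> where "\<kappa> = kappa (v0, v)"
  define V where "V = (norm v)\<^sup>2"
  define g where "g = zero_sum_lift (dx * ds) - centred_squares v"
  define d where "d = scaled_res z - 1"
  define z' where "z' = pred_point z dx ds \<alpha>"
  define D where "D = scaled_res z' - 1"
  have z'_eq: "z' = (x + \<alpha> *\<^sub>R dx, s + \<alpha> *\<^sub>R ds, ((1 - \<alpha>) * v0, (1 - \<alpha>) *\<^sub>R v))"
    by (simp add: z'_def z_def)
  have F: "z \<in> feas_z M q" using z by (simp add: N_prox_def)
  have pos: "- (M *v x) + s = q" "0 < x $ i" "0 < s $ i" for i
    using F by (auto simp: z_def feas_z_iff)
  have V: "V < v0" "0 \<le> V" using F by (auto simp: z_def V_def feas_z_iff)
  have \<rho>: "0 < \<rho>" using V by (simp add: \<rho>_def V_def rho_pos del: rho.simps)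
  have n: "1 \<le> n" by (simp add: n_def Suc_le_eq)
  have \<kappa>0: "0 \<le> \<kappa>" using V by (simp add: \<kappa>_def kappa_def V_def)
  have "(n + 1) * \<rho> = v0 - V" using n by (simp add: \<rho>_def n_def V_def)
  moreover have "\<kappa> * (v0 - V) = V" using V by (simp add: \<kappa>_def kappa_def V_def)
  ultimately have "V = (n + 1) * \<rho> * \<kappa>" by (simp add: mult_ac)
  then have W: "V / (n + 1) = \<rho> * \<kappa>" using n by (simp add: field_simps)
  have "\<rho>' = (1 - \<alpha>) * (\<rho> + \<alpha> * (V / (n + 1)))"
    by (simp only: \<rho>'_def \<rho>_def rho_shrink V_def n_def)
  then have \<rho>'_eq: "\<rho>' = \<rho> * ((1 - \<alpha>) * (1 + \<alpha> * \<kappa>))"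
    unfolding W by (simp add: algebra_simps)
  have "\<alpha> * 1 \<le> \<alpha> * ((1 + \<kappa>) * sqrt n)"
    using \<alpha>(1) \<kappa>0 n mult_mono[of 1 "1 + \<kappa>" 1 "sqrt n"] by (intro mult_left_mono) auto
  then have \<alpha>_le: "\<alpha> \<le> 5 / 16" using \<alpha>(2) by (simp add: \<kappa>_def n_def mult.assoc)
  have "11 / 16 * 1 \<le> (1 - \<alpha>) * (1 + \<alpha> * \<kappa>)"
    using \<alpha>_le \<alpha>(1) \<kappa>0 by (intro mult_mono) auto
  then have \<rho>'_ge: "11 / 16 * \<rho> \<le> \<rho>'" unfolding \<rho>'_eq using \<rho> by (simp add: mult.commute)
  then have \<rho>': "0 < \<rho>'" using \<rho> by linarith
  have nd: "norm d \<le> 1 / 3"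
    using N_prox_bounds(2)[of x s "(v0, v)" M q "1 / 4"] z by (simp add: z_def d_def)
  have "(\<alpha> * (1 + \<kappa>) * sqrt n)\<^sup>2 \<le> (5 / 16)\<^sup>2"
    using \<alpha> \<kappa>0 n by (intro power_mono) (auto simp: \<kappa>_def n_def)
  then have small: "\<alpha>\<^sup>2 * (1 + \<kappa>)\<^sup>2 * n \<le> 25 / 256"
    using n by (simp add: power_mult_distrib power_divide)
  have "norm g \<le> 32 / 25 * (n * \<rho> * (1 + \<kappa>)\<^sup>2)"
    unfolding g_def n_def \<rho>_def \<kappa>_def
    by (rule predictor_second_order_bound(1)[OF M z[unfolded z_def] \<theta> dir[unfolded z_def]])
  then have "\<alpha>\<^sup>2 * norm g \<le> \<alpha>\<^sup>2 * (32 / 25 * (n * \<rho> * (1 + \<kappa>)\<^sup>2))"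
    by (rule mult_left_mono) simp
  also have "\<dots> = 32 / 25 * \<rho> * (\<alpha>\<^sup>2 * (1 + \<kappa>)\<^sup>2 * n)" by simp
  also have "\<dots> \<le> 32 / 25 * \<rho> * (25 / 256)" using \<rho> by (intro mult_left_mono small) auto
  finally have ng: "\<alpha>\<^sup>2 * norm g \<le> \<rho> / 8" by simp
  have "rho ((1 - \<alpha>) * v0, (1 - \<alpha>) *\<^sub>R v) = \<rho>'"
    by (simp add: \<rho>'_def del: rho.simps)
  then have scaled': "scaled_res z' $ j = res z' $ j / \<rho>'" for j
    by (simp only: scaled_res_def z'_eq snd_conv vec_lambda_beta)
  have res': "res z' = \<rho>' *\<^sub>R 1 + (1 - \<theta> * \<alpha>) *\<^sub>R (res z - \<rho> *\<^sub>R 1) + \<alpha>\<^sup>2 *\<^sub>R g"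
    unfolding z'_def z_def \<rho>'_def \<rho>_def g_def by (rule res_pred_point[OF dir[unfolded z_def]])
  have "res z - \<rho> *\<^sub>R 1 = \<rho> *\<^sub>R d"
    using \<rho> by (simp add: vec_eq_iff d_def scaled_res_def z_def \<rho>_def[symmetric] field_simps
        del: rho.simps)
  moreover have "res z' - \<rho>' *\<^sub>R 1 = \<rho>' *\<^sub>R D"
    using \<rho>' by (simp add: vec_eq_iff D_def scaled' right_diff_distrib)
  ultimately have D_eq: "\<rho>' *\<^sub>R D = ((1 - \<theta> * \<alpha>) * \<rho>) *\<^sub>R d + \<alpha>\<^sup>2 *\<^sub>R g"
    unfolding res' by (simp add: algebra_simps)
  have "\<rho>' * norm D = norm (((1 - \<theta> * \<alpha>) * \<rho>) *\<^sub>R d + \<alpha>\<^sup>2 *\<^sub>R g)"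
    using \<rho>' by (simp add: D_eq[symmetric])
  also have "\<dots> \<le> \<bar>(1 - \<theta> * \<alpha>) * \<rho>\<bar> * norm d + \<alpha>\<^sup>2 * norm g"
    by (rule norm_triangle_le) simp
  also have "\<dots> \<le> \<rho> * (1 / 3) + \<rho> / 8"
  proof (intro add_mono ng mult_mono nd)
    show "\<bar>(1 - \<theta> * \<alpha>) * \<rho>\<bar> \<le> \<rho>"
      using \<theta> \<alpha>(1) \<alpha>_le \<rho> by (auto simp: abs_mult)
  qed (use \<rho> in auto)
  also have "\<dots> = 2 / 3 * (11 / 16 * \<rho>)" by simp
  also have "\<dots> \<le> 2 / 3 * \<rho>'" using \<rho>'_ge by simp
  finally have nD: "norm D \<le> 2 / 3" using \<rho>' by (simp add: mult.commute)
  have w': "0 < rho ((1 - \<alpha>) * v0, (1 - \<alpha>) *\<^sub>R v)" using \<rho>' by (simp add: \<rho>'_def)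
  have res_pos: "0 < res z' $ j" for j
  proof -
    have "- (2 / 3) \<le> D $ j" using component_le_norm_cart[of D j] nD by simp
    then have "0 < scaled_res z' $ j" by (simp add: D_def)
    then show ?thesis using w' by (simp add: scaled_res_def z'_eq zero_less_divide_iff del: rho.simps)
  qed
  have v': "(norm ((1 - \<alpha>) *\<^sub>R v))\<^sup>2 < (1 - \<alpha>) * v0"
    using w' by (simp add: zero_less_divide_iff)
  have "z' \<in> feas_z M q"
    unfolding z'_eq
  proof (rule feas_z_step[OF pos(1-3) dir[unfolded z_def]])
    show "- 2 * (x $ i * s $ i) < (a_ut (x, s, v0, v) + \<theta> *\<^sub>R a_c (x, s, v0, v)) $ i" for i
      by (rule predictor_second_order_bound(2)[OF M z[unfolded z_def] \<theta> dir[unfolded z_def]])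
  qed (use \<alpha>(1) \<alpha>_le v' res_pos z'_eq in auto)
  moreover have "Psi z' \<le> omega_star (2 / 3)"
  proof -
    have "Psi z' = - (\<Sum>j\<in>UNIV. ln (1 + D $ j))"
      unfolding z'_eq using Psi_eq[OF w' res_pos[unfolded z'_eq]] by (simp add: D_def z'_eq)
    also have "\<dots> \<le> omega_star (2 / 3)"
    proof (rule log_barrier_le_omega_star)
      show "(\<Sum>j\<in>UNIV. D $ j) = 0"
        using sum_scaled_res[OF less_imp_neq[OF w', symmetric]]
        by (simp add: D_def z'_eq)
    qed (use nD in auto)
    finally show ?thesis .
  qed
  ultimately show ?thesis by (simp add: N_Psi_def z'_def)
qed

text \<open>
  With \<open>t = \<alpha> (1 + \<kappa>)\<close> and \<open>h = 1 / (4 \<surd>n) \<le> 1/4\<close>, the factor by which \<open>\<mu>\<^sup>*\<close> shrinks is at most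
  \<open>1 / (1 + t)\<close>, and \<open>exp h \<le> 1 + h + h\<^sup>2 \<le> 1 + 5/4 h \<le> 1 + t\<close>. This is where the constant \<open>5/16\<close>
  comes from.
\<close>
lemma mu_star_shrink:
  fixes v :: "real ^ 'n"
  assumes V: "(norm v)\<^sup>2 < v0" and \<alpha>: "0 \<le> \<alpha>" "\<alpha> < 1"
    and large: "5 / 16 \<le> \<alpha> * (1 + kappa (v0, v)) * sqrt (real CARD('n))"
  shows "0 < mu_star ((1 - \<alpha>) *\<^sub>R (v0, v))"
    and "ln (mu_star ((1 - \<alpha>) *\<^sub>R (v0, v))) \<le> ln (mu_star (v0, v)) - 1 / (4 * sqrt (real CARD('n)))"
proof -
  define n where "n = real CARD('n)"
  define \<kappa> where "\<kappa> = kappa (v0, v)"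
  define U where "U = (norm v)\<^sup>2"
  define \<mu> where "\<mu> = mu_star (v0, v)"
  define h where "h = 1 / (4 * sqrt n)"
  have U: "U < v0" "0 \<le> U" using V by (auto simp: U_def)
  have n: "1 \<le> n" by (simp add: n_def Suc_le_eq)
  have \<kappa>: "U = \<kappa> * (v0 - U)" "0 \<le> \<kappa>" using U by (auto simp: \<kappa>_def kappa_def U_def)
  have \<mu>: "\<mu> = v0\<^sup>2 / (v0 - U)" by (simp add: \<mu>_def U_def)
  then have \<mu>0: "0 < \<mu>" using U by simp
  have den: "(1 - \<alpha>) * v0 - (1 - \<alpha>)\<^sup>2 * U = (1 - \<alpha>) * ((v0 - U) * (1 + \<alpha> * \<kappa>))"
  proof -
    have "(1 - \<alpha>) * v0 - (1 - \<alpha>)\<^sup>2 * U = (1 - \<alpha>) * ((v0 - U) + \<alpha> * U)"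
      by (simp add: power2_eq_square algebra_simps)
    also have "\<alpha> * U = \<alpha> * (\<kappa> * (v0 - U))" using \<kappa>(1) by (rule arg_cong)
    also have "(v0 - U) + \<dots> = (v0 - U) * (1 + \<alpha> * \<kappa>)" by (simp add: algebra_simps)
    finally show ?thesis .
  qed
  have pos: "0 < 1 + \<alpha> * \<kappa>" using \<alpha>(1) \<kappa>(2) by (simp add: add_pos_nonneg)
  have "mu_star ((1 - \<alpha>) *\<^sub>R (v0, v)) = ((1 - \<alpha>) * v0)\<^sup>2 / ((1 - \<alpha>) * v0 - (1 - \<alpha>)\<^sup>2 * U)"
    by (simp add: U_def power_mult_distrib)
  also have "\<dots> = (1 - \<alpha>) / (1 + \<alpha> * \<kappa>) * \<mu>"
    unfolding den \<mu> using \<alpha> U by (simp add: power2_eq_square mult_ac)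
  finally have eq: "mu_star ((1 - \<alpha>) *\<^sub>R (v0, v)) = (1 - \<alpha>) / (1 + \<alpha> * \<kappa>) * \<mu>" .
  show pos': "0 < mu_star ((1 - \<alpha>) *\<^sub>R (v0, v))"
    unfolding eq using \<alpha> pos \<mu>0 by simp
  define t where "t = \<alpha> * (1 + \<kappa>)"
  have t: "5 / 4 * h \<le> t"
    using large n by (simp add: t_def h_def \<kappa>_def n_def field_simps)
  have h: "0 < h" "h \<le> 1 / 4" using n by (auto simp: h_def field_simps)
  have "exp h \<le> 1 + h + h\<^sup>2" using h by (intro exp_bound) auto
  also have "h\<^sup>2 \<le> h * (1 / 4)" unfolding power2_eq_square using h by (intro mult_left_mono) auto
  finally have exp_le: "exp h \<le> 1 + t" using t by simp
  have "(1 - \<alpha>) * exp h \<le> (1 - \<alpha>) * (1 + t)" using \<alpha> by (intro mult_left_mono exp_le) auto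
  also have "\<dots> = 1 + \<alpha> * \<kappa> - \<alpha>\<^sup>2 * (1 + \<kappa>)"
    by (simp add: t_def power2_eq_square algebra_simps)
  also have "\<dots> \<le> 1 + \<alpha> * \<kappa>" using \<kappa>(2) by simp
  finally have "(1 - \<alpha>) / (1 + \<alpha> * \<kappa>) \<le> exp (- h)"
    using pos by (simp add: exp_minus field_simps)
  then have "mu_star ((1 - \<alpha>) *\<^sub>R (v0, v)) \<le> exp (- h) * \<mu>"
    unfolding eq using \<mu>0 by (intro mult_right_mono) auto
  then have "ln (mu_star ((1 - \<alpha>) *\<^sub>R (v0, v))) \<le> ln (exp (- h) * \<mu>)"
    using pos' by simp
  also have "\<dots> = ln \<mu> - h" using \<mu>0 by (simp add: ln_mult)
  finally show "ln (mu_star ((1 - \<alpha>) *\<^sub>R (v0, v))) \<le> ln (mu_star (v0, v)) - 1 / (4 * sqrt (real CARD('n)))"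
    by (simp only: \<mu>_def h_def n_def)
qed

section \<open>The corrector step\<close>

lemma res_corr_point:
  fixes x s v :: "real ^ 'n" and v0 :: real
  defines "z \<equiv> (x, s, (v0, v))"
  assumes dir: "is_direction M z (a_c z) dx ds"
  shows "res (corr_point z dx ds \<alpha>) =
    res z + \<alpha> *\<^sub>R (rho (v0, v) *\<^sub>R 1 - res z) + \<alpha>\<^sup>2 *\<^sub>R zero_sum_lift (dx * ds)" (is "?l = ?r")
proof (rule vec_eq_option)
  define r where "r = rho (v0, v)"
  fix i
  have "(s * dx + x * ds) $ i = a_c z $ i"
    using dir unfolding z_def is_direction.simps by (simp only:)
  then have a: "s $ i * dx $ i + x $ i * ds $ i = r - x $ i * s $ i + (v $ i)\<^sup>2"
    by (simp add: z_def r_def del: rho.simps)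
  have "(x $ i + \<alpha> * dx $ i) * (s $ i + \<alpha> * ds $ i)
      = x $ i * s $ i + \<alpha> * (s $ i * dx $ i + x $ i * ds $ i) + \<alpha>\<^sup>2 * (dx $ i * ds $ i)"
    by (simp add: algebra_simps power2_eq_square)
  then show "?l $ Some i = ?r $ Some i"
    unfolding a by (simp add: z_def r_def[symmetric] algebra_simps del: rho.simps)
next
  have "(\<Sum>j\<in>UNIV. ?l $ j) = (real CARD('n) + 1) * rho (v0, v)"
    unfolding z_def corr_point.simps by (rule sum_res)
  moreover have "(\<Sum>j\<in>UNIV. res z $ j) = (real CARD('n) + 1) * rho (v0, v)"
    unfolding z_def by (rule sum_res)
  ultimately show "(\<Sum>j\<in>UNIV. ?l $ j) = (\<Sum>j\<in>UNIV. ?r $ j)"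
    by (simp add: sum.distrib sum_subtractf sum_distrib_left[symmetric] algebra_simps
        del: rho.simps)
qed

lemma sum_inverse_minus_one:
  fixes u :: "real ^ 'a"
  assumes "\<And>j. 0 < u $ j" "(\<Sum>j\<in>UNIV. u $ j - 1) = 0"
  shows "(\<Sum>j\<in>UNIV. 1 / u $ j - 1) = (\<Sum>j\<in>UNIV. (u $ j - 1)\<^sup>2 / u $ j)"
proof -
  have "(u $ j - 1)\<^sup>2 / u $ j = (1 / u $ j - 1) + (u $ j - 1)" for j
    using assms(1)[of j] by (simp add: field_simps power2_eq_square)
  then have "(\<Sum>j\<in>UNIV. (u $ j - 1)\<^sup>2 / u $ j) = (\<Sum>j\<in>UNIV. 1 / u $ j - 1) + (\<Sum>j\<in>UNIV. u $ j - 1)"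
    by (simp only: sum.distrib)
  then show ?thesis using assms(2) by simp
qed

lemma log_barrier_nonneg:
  fixes u :: "real ^ 'a"
  assumes "\<And>j. 0 < u $ j" "(\<Sum>j\<in>UNIV. u $ j - 1) = 0"
  shows "0 \<le> - (\<Sum>j\<in>UNIV. ln (u $ j))"
proof -
  have "(\<Sum>j\<in>UNIV. ln (u $ j)) \<le> (\<Sum>j\<in>UNIV. u $ j - 1)"
    by (intro sum_mono ln_le_minus_one assms)
  then show ?thesis using assms(2) by simp
qed

text \<open>
  The other components cannot compensate for a small one, as \<open>ln u\<^sub>i \<le> u\<^sub>i - 1\<close> sums to at most \<open>1\<close> over them.
\<close>
lemma log_barrier_component_bounds:
  fixes u :: "real ^ 'a"
  assumes pos: "\<And>j. 0 < u $ j" and sum0: "(\<Sum>j\<in>UNIV. u $ j - 1) = 0"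
    and K: "- (\<Sum>j\<in>UNIV. ln (u $ j)) \<le> K"
  shows "1 / u $ j \<le> exp (K + 1)" and "u $ j \<le> real CARD('a)"
proof -
  have "(\<Sum>i\<in>UNIV - {j}. ln (u $ i)) \<le> (\<Sum>i\<in>UNIV - {j}. u $ i - 1)"
    by (intro sum_mono ln_le_minus_one pos)
  moreover have "(\<Sum>i\<in>UNIV. ln (u $ i)) = ln (u $ j) + (\<Sum>i\<in>UNIV - {j}. ln (u $ i))"
    by (intro sum.remove) auto
  moreover have "(\<Sum>i\<in>UNIV. u $ i - 1) = (u $ j - 1) + (\<Sum>i\<in>UNIV - {j}. u $ i - 1)"
    by (intro sum.remove) auto
  ultimately have "- ln (u $ j) \<le> K + 1"
    using K sum0 pos[of j] by linarith
  then have "exp (- ln (u $ j)) \<le> exp (K + 1)" by simp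
  then show "1 / u $ j \<le> exp (K + 1)" using pos[of j] by (simp add: exp_minus divide_inverse)
  have "u $ j \<le> (\<Sum>j\<in>UNIV. u $ j)" using pos by (intro member_le_sum) (auto simp: less_imp_le)
  also have "\<dots> = real CARD('a)" using sum0 by (simp add: sum_subtractf)
  finally show "u $ j \<le> real CARD('a)" .
qed

text \<open>
  The products \<open>x\<^sub>i s\<^sub>i\<close> are at least the residuals \<open>r\<^sub>i\<close>, so \<open>\<Sum> a\<^sub>i\<^sup>2 / (x\<^sub>i s\<^sub>i)\<close> is at most
  \<open>\<Sum> (\<rho> - r\<^sub>j)\<^sup>2 / r\<^sub>j\<close>, which is \<open>\<rho>\<close> times the sum on the right.
\<close>
lemma corrector_second_order_bound:
  fixes x s v :: "real ^ 'n" and v0 :: real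
  defines "z \<equiv> (x, s, (v0, v))"
  assumes M: "pos_semidef M" and z: "z \<in> feas_z M q"
    and dir: "is_direction M z (a_c z) dx ds"
  shows "norm (zero_sum_lift (dx * ds)) \<le> rho (v0, v) * (\<Sum>j\<in>UNIV. 1 / scaled_res z $ j - 1)"
proof -
  define r where "r = rho (v0, v)"
  define u where "u = scaled_res z"
  have pos: "0 < x $ i" "0 < s $ i" "0 < res z $ j" for i j using z by (auto simp: z_def feas_z_iff)
  have r: "0 < r" using z by (simp add: z_def feas_z_iff r_def rho_pos del: rho.simps)
  have res_eq: "res z $ j = r * u $ j" for j
    using r by (simp add: u_def scaled_res_def z_def r_def[symmetric] del: rho.simps)
  have u: "0 < u $ j" for j using pos(3)[of j] r by (simp add: res_eq zero_less_mult_iff)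
  have u0: "(\<Sum>j\<in>UNIV. u $ j - 1) = 0"
    using sum_scaled_res[of v0 v x s] r by (simp add: u_def z_def r_def del: rho.simps)
  have "(a_c z $ i)\<^sup>2 / (x $ i * s $ i) \<le> r * ((u $ Some i - 1)\<^sup>2 / u $ Some i)" for i
  proof -
    have "x $ i * s $ i - (v $ i)\<^sup>2 = r * u $ Some i"
      using res_eq[of "Some i"] by (simp add: z_def)
    then have xs: "x $ i * s $ i = r * u $ Some i + (v $ i)\<^sup>2" by simp
    have "a_c z $ i = r - x $ i * s $ i + (v $ i)\<^sup>2"
      by (simp add: z_def r_def del: rho.simps)
    then have a: "a_c z $ i = r * (1 - u $ Some i)" unfolding xs by (simp add: algebra_simps)
    have "(a_c z $ i)\<^sup>2 / (x $ i * s $ i) \<le> (a_c z $ i)\<^sup>2 / (r * u $ Some i)"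
      using pos(1)[of i] pos(2)[of i] u[of "Some i"] r by (intro divide_left_mono) (auto simp: xs add_pos_nonneg)
    also have "\<dots> = r * ((u $ Some i - 1)\<^sup>2 / u $ Some i)"
      using r u[of "Some i"] unfolding a by (simp add: power2_eq_square) (simp add: algebra_simps)
    finally show ?thesis .
  qed
  then have "(\<Sum>i\<in>UNIV. (a_c z $ i)\<^sup>2 / (x $ i * s $ i))
      \<le> (\<Sum>i\<in>UNIV. r * ((u $ Some i - 1)\<^sup>2 / u $ Some i))"
    by (rule sum_mono)
  also have "\<dots> \<le> r * (\<Sum>j\<in>UNIV. (u $ j - 1)\<^sup>2 / u $ j)"
  proof -
    have "0 \<le> (u $ None - 1)\<^sup>2 / u $ None" using u[of None] by (simp add: less_imp_le)
    then show ?thesis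
      unfolding sum_distrib_left[symmetric] sum_option[of "\<lambda>j. (u $ j - 1)\<^sup>2 / u $ j"]
      using r by (intro mult_left_mono) auto
  qed
  finally have A: "(\<Sum>i\<in>UNIV. (a_c z $ i)\<^sup>2 / (x $ i * s $ i))
      \<le> r * (\<Sum>j\<in>UNIV. 1 / u $ j - 1)"
    by (simp only: sum_inverse_minus_one[OF u u0])
  have "s * dx + x * ds = a_c z" using dir unfolding z_def is_direction.simps by blast
  moreover have "0 \<le> dx \<bullet> ds" using direction_monotone[OF M] dir unfolding z_def by blast
  ultimately have "2 * sqrt 2 * norm (zero_sum_lift (dx * ds)) \<le> (\<Sum>i\<in>UNIV. (a_c z $ i)\<^sup>2 / (x $ i * s $ i))"
    by (rule norm_lift_product_le[OF pos(1,2)])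
  then have "2 * sqrt 2 * norm (zero_sum_lift (dx * ds)) \<le> r * (\<Sum>j\<in>UNIV. 1 / u $ j - 1)"
    using A by (rule order_trans)
  moreover have "1 * norm (zero_sum_lift (dx * ds)) \<le> 2 * sqrt 2 * norm (zero_sum_lift (dx * ds))"
  proof (rule mult_right_mono)
    have "1 \<le> sqrt 2" by simp
    then show "1 \<le> 2 * sqrt 2" by linarith
  qed simp
  ultimately show ?thesis unfolding r_def u_def by linarith
qed

lemma corrector_admissible_iff:
  fixes x s v :: "real ^ 'n" and v0 :: real
  defines "z \<equiv> (x, s, (v0, v))"
  assumes z: "z \<in> feas_z M q" and dir: "is_direction M z (a_c z) dx ds"
    and \<alpha>: "0 \<le> \<alpha>" "\<alpha> \<le> 1"
  shows "corr_point z dx ds \<alpha> \<in> feas_z M q \<longleftrightarrow> (\<forall>j. 0 < res (corr_point z dx ds \<alpha>) $ j)"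
proof
  show "\<forall>j. 0 < res (corr_point z dx ds \<alpha>) $ j" if "corr_point z dx ds \<alpha> \<in> feas_z M q"
    using that by (simp add: z_def feas_z_iff)
next
  assume res: "\<forall>j. 0 < res (corr_point z dx ds \<alpha>) $ j"
  have pos: "- (M *v x) + s = q" "0 < x $ i" "0 < s $ i" "(norm v)\<^sup>2 < v0" for i
    using z by (auto simp: z_def feas_z_iff)
  have "0 < rho (v0, v)" by (rule rho_pos[OF pos(4)])
  then have a: "- 2 * (x $ i * s $ i) < a_c (x, s, v0, v) $ i" for i
    using pos(2)[of i] pos(3)[of i] by (simp add: add_pos_nonneg less_imp_le del: rho.simps)
  show "corr_point z dx ds \<alpha> \<in> feas_z M q"
    unfolding z_def corr_point.simps
    by (rule feas_z_step[OF pos(1-3) dir[unfolded z_def] \<alpha> a pos(4)])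
      (use res in \<open>simp add: z_def\<close>)
qed

text \<open>
  The barrier blows up at the boundary of the admissible set. Maximising the product of the
  residuals over the compact set on which they are nonnegative avoids this singularity: the maximum
  is positive, so it is attained at an admissible step length.
\<close>
lemma corrector_length_exists:
  fixes x s v :: "real ^ 'n" and v0 :: real
  defines "z \<equiv> (x, s, (v0, v))"
  assumes z: "z \<in> feas_z M q" and dir: "is_direction M z (a_c z) dx ds"
  shows "\<exists>\<alpha>. is_corr_length M q z dx ds \<alpha>"
proof -
  define r where "r = (\<lambda>\<alpha> j. res (corr_point z dx ds \<alpha>) $ j)"
  define P where "P = (\<lambda>\<alpha>. \<Prod>j\<in>UNIV. r \<alpha> j)"
  define S where "S = {0..1} \<inter> (\<Inter>j. {\<alpha>. 0 \<le> r \<alpha> j})"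
  have r_eq: "r \<alpha> j = res z $ j + \<alpha> * (rho (v0, v) - res z $ j) + \<alpha>\<^sup>2 * zero_sum_lift (dx * ds) $ j" for \<alpha> j
    unfolding r_def z_def res_corr_point[OF dir[unfolded z_def]] by simp
  have cont: "continuous_on A (\<lambda>\<alpha>. r \<alpha> j)" for A j
    unfolding r_eq by (intro continuous_intros)
  have "compact S"
    unfolding S_def
    by (intro compact_Int_closed compact_Icc closed_INT ballI closed_Collect_le cont continuous_on_const)
  have r0: "0 < r 0 j" for j
    using z by (simp add: r_eq z_def feas_z_iff)
  then have "0 \<in> S" by (auto simp: S_def less_imp_le)
  have "continuous_on S P" unfolding P_def by (intro continuous_on_prod cont)
  then obtain a where a: "a \<in> S" and max: "\<And>y. y \<in> S \<Longrightarrow> P y \<le> P a"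
    using continuous_attains_sup[OF \<open>compact S\<close>] \<open>0 \<in> S\<close> by blast
  have "0 < P 0" unfolding P_def by (intro prod_pos) (use r0 in blast)
  then have Pa: "0 < P a" using max[OF \<open>0 \<in> S\<close>] by linarith
  have ra: "0 < r a j" for j
  proof -
    have "r a j \<noteq> 0" using Pa unfolding P_def by (metis UNIV_I finite less_irrefl prod_zero)
    moreover have "0 \<le> r a j" using a by (simp add: S_def)
    ultimately show ?thesis by simp
  qed
  have adm: "corr_point z dx ds \<alpha> \<in> feas_z M q \<longleftrightarrow> (\<forall>j. 0 < r \<alpha> j)" if "\<alpha> \<in> {0..1}" for \<alpha>
    unfolding r_def z_def
    by (rule corrector_admissible_iff[OF z[unfolded z_def] dir[unfolded z_def]]) (use that in auto)
  have bar: "barrier (corr_point z dx ds \<alpha>) = - ln (P \<alpha>)" if "\<And>j. 0 < r \<alpha> j" for \<alpha>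
    unfolding barrier_def P_def
    by (subst ln_prod) (use that in \<open>auto simp: r_def less_imp_neq[symmetric]\<close>)
  have "is_corr_length M q z dx ds a"
    unfolding is_corr_length_def is_arg_min_def
  proof (intro conjI notI)
    show "a \<in> {0..1}" using a by (simp add: S_def)
    then show "corr_point z dx ds a \<in> feas_z M q" using adm ra by blast
    assume "\<exists>y. (y \<in> {0..1} \<and> corr_point z dx ds y \<in> feas_z M q) \<and>
      barrier (corr_point z dx ds y) < barrier (corr_point z dx ds a)"
    then obtain y where y: "y \<in> {0..1}" "corr_point z dx ds y \<in> feas_z M q"
      "barrier (corr_point z dx ds y) < barrier (corr_point z dx ds a)" by blast
    have ry: "0 < r y j" for j using adm y by blast
    then have "y \<in> S" using y(1) by (auto simp: S_def less_imp_le)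
    then have "P y \<le> P a" by (rule max)
    moreover have "0 < P y" unfolding P_def by (intro prod_pos) (use ry in blast)
    ultimately have "ln (P y) \<le> ln (P a)" by simp
    then show False using y(3) bar[OF ry] bar[OF ra] by simp
  qed
  then show ?thesis by blast
qed

lemma Psi_eq_barrier:
  fixes x s :: "real ^ 'n"
  assumes "0 < rho w" "\<And>j. 0 < res (x, s, w) $ j"
  shows "Psi (x, s, w) = barrier (x, s, w) + (real CARD('n) + 1) * ln (rho w)"
proof -
  have ln_eq: "ln (scaled_res (x, s, w) $ j) = ln (res (x, s, w) $ j) - ln (rho w)" for j
    using assms(1) assms(2)[of j] by (simp add: scaled_res_def ln_div)
  show ?thesis
    unfolding Psi_eq[OF assms] barrier_def ln_eq sum_subtractf by (simp add: distrib_right)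
qed

text \<open>
  It suffices to exhibit one admissible \<open>t\<close> with this decrease. The residuals at \<open>t\<close> are
  \<open>r\<^sub>j (1 + E\<^sub>j)\<close> with \<open>E\<^sub>j = t p\<^sub>j + t\<^sup>2 h\<^sub>j / r\<^sub>j\<close> and \<open>p = 1 / u - 1\<close>. The linear term lowers the barrier
  by \<open>t G\<close>, where \<open>G = \<Sum> p\<^sub>j\<close> is the square of \<open>zeta0\<close>, and the other terms cost at most a multiple
  of \<open>t\<^sup>2\<close>, because the bound on \<open>Psi\<close> controls \<open>p\<close> and \<open>h / r\<close>. Being outside the proximity
  neighbourhood means \<open>\<beta> \<parallel>p\<parallel> < G\<close>; together with \<open>G = \<Sum> u\<^sub>j p\<^sub>j\<^sup>2 \<le> (n + 1) \<parallel>p\<parallel>\<^sup>2\<close> this bounds \<open>\<parallel>p\<parallel>\<close> and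
  then \<open>G\<close> away from \<open>0\<close>.
\<close>
lemma corrector_step_decrease:
  fixes x s v :: "real ^ 'n" and v0 :: real
  defines "z \<equiv> (x, s, (v0, v))" and "N \<equiv> real CARD('n) + 1"
  assumes M: "pos_semidef M" and \<beta>: "0 < \<beta>" "\<beta> \<le> 1" and K: "0 \<le> K"
    and z: "z \<in> N_Psi M q K" and far: "z \<notin> N_prox M q \<beta>"
    and dir: "is_direction M z (a_c z) dx ds" and len: "is_corr_length M q z dx ds \<alpha>"
  shows "corr_point z dx ds \<alpha> \<in> feas_z M q"
    and "Psi (corr_point z dx ds \<alpha>) \<le> Psi z - \<beta> ^ 4 / (100 * N ^ 5 * exp (K + 1) ^ 4)"
proof -
  define r where "r = rho (v0, v)"
  define u where "u = scaled_res z"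
  define h where "h = zero_sum_lift (dx * ds)"
  define c where "c = exp (K + 1)"
  define B where "B = N * c\<^sup>2"
  define p where "p = (\<chi> j. 1 / u $ j - 1)"
  define G where "G = (\<Sum>j\<in>UNIV. p $ j)"
  define g where "g = \<beta>\<^sup>2 / N"
  \<comment> \<open>\<open>g\<close> is the lower bound for \<open>G\<close>; with this \<open>t\<close> the second-order cost is \<open>9/10\<close> of the gain \<open>t g\<close>.\<close>
  define t where "t = g / (10 * N * B\<^sup>2)"
  define E where "E = (\<lambda>j. t * p $ j + t\<^sup>2 * (h $ j / res z $ j))"
  have N: "1 \<le> N" "real CARD('n option) = N" by (auto simp: N_def)
  have c: "1 \<le> c" using K by (simp add: c_def)
  have c_sq: "c \<le> c\<^sup>2" "1 \<le> c\<^sup>2" using c self_le_power[of c 2] one_le_power[of c 2] by auto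
  have B: "1 \<le> B" "c \<le> B" "N * c * c = B"
    using mult_mono[of 1 N 1 "c\<^sup>2"] mult_mono[of 1 N c "c\<^sup>2"] N c c_sq
    by (auto simp: B_def power2_eq_square)
  have F: "z \<in> feas_z M q" using z by (simp add: N_Psi_def)
  have v: "(norm v)\<^sup>2 < v0" using F by (auto simp: z_def feas_z_iff)
  have res_pos: "0 < res z $ j" for j using F by (auto simp: z_def feas_z_iff)
  have r: "0 < r" unfolding r_def by (rule rho_pos[OF v])
  have res_eq: "res z $ j = r * u $ j" for j
    using r by (simp add: u_def scaled_res_def z_def r_def[symmetric] del: rho.simps)
  have u: "0 < u $ j" for j using res_pos[of j] r by (simp add: res_eq zero_less_mult_iff)
  have u0: "(\<Sum>j\<in>UNIV. u $ j - 1) = 0"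
    using sum_scaled_res[of v0 v x s] r by (simp add: u_def z_def r_def del: rho.simps)
  have "Psi z = - (\<Sum>j\<in>UNIV. ln (u $ j))"
    unfolding u_def z_def by (rule Psi_eq) (use r res_pos in \<open>auto simp: r_def z_def simp del: rho.simps\<close>)
  then have uK: "- (\<Sum>j\<in>UNIV. ln (u $ j)) \<le> K" using z by (simp add: N_Psi_def)
  have u_lo: "1 / u $ j \<le> c" for j
    unfolding c_def by (rule log_barrier_component_bounds(1)[OF u u0 uK])
  have u_hi: "u $ j \<le> N" for j
    using log_barrier_component_bounds(2)[OF u u0 uK, of j] N by simp
  have G_sq: "G = (\<Sum>j\<in>UNIV. u $ j * (p $ j)\<^sup>2)"
  proof -
    have "G = (\<Sum>j\<in>UNIV. (u $ j - 1)\<^sup>2 / u $ j)"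
      unfolding G_def p_def using sum_inverse_minus_one[OF u u0] by simp
    also have "\<dots> = (\<Sum>j\<in>UNIV. u $ j * (p $ j)\<^sup>2)"
    proof (intro sum.cong refl)
      fix j show "(u $ j - 1)\<^sup>2 / u $ j = u $ j * (p $ j)\<^sup>2"
        using u[of j] by (simp add: p_def field_simps power2_eq_square)
    qed
    finally show ?thesis .
  qed
  have G_zeta: "(zeta0 z)\<^sup>2 = G" "zeta1 z = norm p"
    using zeta0_squared_eq[of "(v0, v)" x s] zeta1_eq[of "(v0, v)" x s] r res_pos
    by (simp_all add: G_def p_def u_def z_def r_def del: rho.simps)
  have "\<not> prox z \<le> \<beta>" using far F by (simp add: N_prox_def)
  then have np: "0 < norm p" and "\<beta> < G / norm p"
    using \<beta>(1) by (auto simp: prox_def G_zeta split: if_splits)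
  then have G_gt: "\<beta> * norm p < G" by (simp add: pos_less_divide_eq)
  have "G \<le> (\<Sum>j\<in>UNIV. N * (p $ j)\<^sup>2)"
    unfolding G_sq by (intro sum_mono mult_right_mono u_hi) auto
  then have "G \<le> N * (norm p)\<^sup>2" by (simp add: norm_square_sum sum_distrib_left)
  then have "\<beta> * norm p < (N * norm p) * norm p" using G_gt by (simp add: power2_eq_square)
  then have "\<beta> < N * norm p" using np by (simp only: mult_less_cancel_right_pos)
  then have "\<beta> / N < norm p" using N by (simp add: pos_divide_less_eq mult.commute)
  then have "\<beta> * (\<beta> / N) \<le> \<beta> * norm p" using \<beta> by (intro mult_left_mono) auto
  then have gG: "g \<le> G" using G_gt by (simp add: g_def power2_eq_square)
  have g: "0 < g" "g \<le> 1"
    using \<beta> N power_le_one[of \<beta> 2] by (auto simp: g_def pos_divide_le_eq)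
  have B_sq: "B \<le> B\<^sup>2" "0 < B\<^sup>2" using B self_le_power[of B 2] by auto
  have t: "0 < t" using g N B by (simp add: t_def)
  have tNB: "t * (N * B\<^sup>2) = g / 10" using N B by (simp add: t_def)
  have "t * B \<le> t * (N * B\<^sup>2)"
    using t N B_sq B mult_mono[of 1 N B "B\<^sup>2"] by (intro mult_left_mono) auto
  then have tB: "t * B \<le> 1 / 10" using tNB g by simp
  have "t * 1 \<le> t * B" using t B by (intro mult_left_mono) auto
  then have t1: "t \<le> 1" using tB by simp
  have G_le: "G \<le> N * c"
  proof -
    have "G \<le> (\<Sum>j\<in>(UNIV :: 'n option set). c)"
      unfolding G_def p_def using u_lo by (intro sum_mono) (simp add: add_increasing2 less_imp_le diff_le_eq)
    then show ?thesis using N by simp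
  qed
  have h_le: "\<bar>h $ j\<bar> \<le> r * (N * c)" for j
  proof -
    have "\<bar>h $ j\<bar> \<le> norm h" by (rule component_le_norm_cart)
    also have "\<dots> \<le> r * G"
      using corrector_second_order_bound[OF M F[unfolded z_def] dir[unfolded z_def]]
      by (simp add: h_def r_def G_def p_def u_def z_def del: rho.simps)
    also have "\<dots> \<le> r * (N * c)" using r G_le by (intro mult_left_mono) auto
    finally show ?thesis .
  qed
  have e_le: "\<bar>h $ j / res z $ j\<bar> \<le> B" for j
  proof -
    have "\<bar>h $ j / res z $ j\<bar> = \<bar>h $ j\<bar> / r * (1 / u $ j)"
      using r u[of j] by (simp add: res_eq abs_mult)
    also have "\<dots> \<le> (N * c) * c"
      using h_le[of j] r u_lo[of j] u[of j] N c by (intro mult_mono) (auto simp: pos_divide_le_eq mult.commute)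
    finally show ?thesis using B(3) by simp
  qed
  have p_le: "\<bar>p $ j\<bar> \<le> B" for j
  proof -
    have "p $ j = 1 / u $ j - 1" "0 < 1 / u $ j" using u[of j] by (simp_all add: p_def)
    then show ?thesis using u_lo[of j] B(1,2) by linarith
  qed
  have E_le: "\<bar>E j\<bar> \<le> 2 * (t * B)" for j
  proof -
    have "\<bar>E j\<bar> \<le> t * \<bar>p $ j\<bar> + t\<^sup>2 * \<bar>h $ j / res z $ j\<bar>"
      unfolding E_def using t by (intro order_trans[OF abs_triangle_ineq]) (simp add: abs_mult)
    also have "\<dots> \<le> t * B + t\<^sup>2 * B"
      using t by (intro add_mono mult_left_mono p_le e_le) auto
    also have "t\<^sup>2 * B \<le> t * B"
      using t t1 B by (intro mult_right_mono) (auto simp: power2_eq_square)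
    finally show ?thesis by linarith
  qed
  have E_half: "\<bar>E j\<bar> \<le> 1 / 2" for j using E_le[of j] tB by linarith
  have ln_E: "- ln (1 + E j) \<le> - t * p $ j + 9 * (t\<^sup>2 * B\<^sup>2)" for j
  proof -
    have "\<bar>ln (1 + E j) - E j\<bar> \<le> 2 * (E j)\<^sup>2"
      by (rule abs_ln_one_plus_x_minus_x_bound[OF E_half])
    moreover have "(E j)\<^sup>2 \<le> (2 * (t * B))\<^sup>2"
      using power_mono[OF E_le[of j], of 2] by simp
    moreover have "(2 * (t * B))\<^sup>2 = 4 * (t\<^sup>2 * B\<^sup>2)" by (simp add: power_mult_distrib)
    moreover have "- E j \<le> - t * p $ j + t\<^sup>2 * B\<^sup>2"
    proof -
      have "t\<^sup>2 * - (h $ j / res z $ j) \<le> t\<^sup>2 * B\<^sup>2"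
      proof (rule mult_left_mono)
        show "- (h $ j / res z $ j) \<le> B\<^sup>2" using e_le[of j] B_sq(1) by linarith
      qed simp
      then show ?thesis by (simp add: E_def)
    qed
    ultimately show ?thesis by linarith
  qed
  have "- (\<Sum>j\<in>UNIV. ln (1 + E j)) = (\<Sum>j\<in>(UNIV :: 'n option set). - ln (1 + E j))"
    by (simp add: sum_negf)
  also have "\<dots> \<le> (\<Sum>j\<in>UNIV. - t * p $ j + 9 * (t\<^sup>2 * B\<^sup>2))"
    by (intro sum_mono ln_E)
  also have "\<dots> = - t * G + N * (9 * (t\<^sup>2 * B\<^sup>2))"
    unfolding sum.distrib sum_distrib_left[symmetric] G_def[symmetric] using N by simp
  also have "N * (9 * (t\<^sup>2 * B\<^sup>2)) = 9 * t * (t * (N * B\<^sup>2))" by (simp add: power2_eq_square)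
  also have "\<dots> = 9 / 10 * (t * g)" unfolding tNB by simp
  also have "- t * G + \<dots> \<le> - (t * g) / 10"
    using mult_left_mono[OF gG less_imp_le[OF t]] by simp
  finally have dec: "- (\<Sum>j\<in>UNIV. ln (1 + E j)) \<le> - (t * g) / 10" .
  have "t * g / 10 = \<beta> ^ 4 / (100 * N ^ 5 * c ^ 4)"
    unfolding t_def g_def B_def using N c by (simp add: power2_eq_square eval_nat_numeral mult_ac)
  note dec = dec[unfolded minus_divide_left[symmetric] this]
  let ?z = "corr_point z dx ds t"
  have res_t: "res ?z $ j = res z $ j * (1 + E j)" for j
  proof -
    have "res ?z $ j = res z $ j + t * (r - res z $ j) + t\<^sup>2 * h $ j"
      unfolding z_def res_corr_point[OF dir[unfolded z_def]] by (simp add: h_def r_def del: rho.simps)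
    also have "r - res z $ j = res z $ j * p $ j"
      using u[of j] by (simp add: res_eq p_def algebra_simps)
    also have "res z $ j + t * (res z $ j * p $ j) + t\<^sup>2 * h $ j = res z $ j * (1 + E j)"
      using res_pos[of j] by (simp add: E_def algebra_simps)
    finally show ?thesis .
  qed
  have E_pos: "0 < 1 + E j" for j using E_half[of j] by linarith
  have adm: "?z \<in> feas_z M q"
    unfolding z_def using res_t res_pos E_pos t t1
    by (subst corrector_admissible_iff[OF F[unfolded z_def] dir[unfolded z_def]]) (auto simp: z_def)
  have "barrier ?z = barrier z - (\<Sum>j\<in>UNIV. ln (1 + E j))"
    unfolding barrier_def res_t using res_pos E_pos by (simp add: ln_mult_pos sum.distrib)
  then have bt: "barrier ?z \<le> barrier z - \<beta> ^ 4 / (100 * N ^ 5 * c ^ 4)" using dec by linarith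
  show adm\<alpha>: "corr_point z dx ds \<alpha> \<in> feas_z M q"
    using len by (simp add: is_corr_length_def is_arg_min_def)
  have "\<not> barrier ?z < barrier (corr_point z dx ds \<alpha>)"
    using len adm t t1 unfolding is_corr_length_def is_arg_min_def by auto
  then have "barrier (corr_point z dx ds \<alpha>) \<le> barrier z - \<beta> ^ 4 / (100 * N ^ 5 * c ^ 4)"
    using bt by linarith
  moreover have "Psi (corr_point z dx ds \<alpha>) = barrier (corr_point z dx ds \<alpha>) + N * ln r"
    using adm\<alpha> r unfolding z_def corr_point.simps N_def r_def
    by (intro Psi_eq_barrier) (auto simp: feas_z_iff simp del: rho.simps)
  moreover have "Psi z = barrier z + N * ln r"
    using F r unfolding z_def N_def r_def
    by (intro Psi_eq_barrier) (auto simp: feas_z_iff simp del: rho.simps)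
  ultimately show "Psi (corr_point z dx ds \<alpha>) \<le> Psi z - \<beta> ^ 4 / (100 * N ^ 5 * exp (K + 1) ^ 4)"
    by (simp add: c_def)
qed

section \<open>Runs of the algorithm\<close>

lemma Psi_nonneg:
  assumes "z \<in> feas_z M q"
  shows "0 \<le> Psi z"
proof -
  obtain x s v0 v where z: "z = (x, s, (v0, v))" by (cases z) auto
  have v: "(norm v)\<^sup>2 < v0" and res: "0 < res (x, s, (v0, v)) $ j" for j
    using assms by (auto simp: z feas_z_iff)
  have r: "0 < rho (v0, v)" by (rule rho_pos[OF v])
  have "0 \<le> - (\<Sum>j\<in>UNIV. ln (scaled_res z $ j))"
  proof (rule log_barrier_nonneg)
    show "(\<Sum>j\<in>UNIV. scaled_res z $ j - 1) = 0" unfolding z by (rule sum_scaled_res[OF less_imp_neq[OF r, symmetric]])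
    show "0 < scaled_res z $ j" for j
      using r res[of j] by (simp add: scaled_res_def z del: rho.simps)
  qed
  then show ?thesis unfolding z by (simp only: Psi_eq[OF r res])
qed

text \<open>
  The longest admissible step is at least the explicit admissible step \<open>a\<close>, and it is shorter than
  \<open>1\<close>, because \<open>w = 0\<close> is not feasible.
\<close>
lemma predictor_progress:
  fixes x s v :: "real ^ 'n" and v0 :: real
  defines "z \<equiv> (x, s, (v0, v))"
  assumes M: "pos_semidef M" and z: "z \<in> N_prox M q (1 / 4)" and ap: "ap = a_ut \<or> ap = a_ac"
    and dir: "is_direction M z (ap z) dx ds"
    and len: "is_pred_length M q (omega_star (2 / 3)) z dx ds \<alpha>"
  shows "pred_point z dx ds \<alpha> \<in> N_Psi M q (omega_star (2 / 3))"
    and "ln (mu_star (snd (snd (pred_point z dx ds \<alpha>))))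
      \<le> ln (mu_star (v0, v)) - 1 / (4 * sqrt (real CARD('n)))"
    and "0 < mu_star (snd (snd (pred_point z dx ds \<alpha>)))"
proof -
  define n where "n = real CARD('n)"
  define \<kappa> where "\<kappa> = kappa (v0, v)"
  define P where "P = (1 + \<kappa>) * sqrt n"
  define a where "a = 5 / (16 * P)"
  have \<theta>: "\<exists>\<theta>. (\<theta> = 0 \<or> \<theta> = 1) \<and> is_direction M z (a_ut z + \<theta> *\<^sub>R a_c z) dx ds"
  proof (cases "ap = a_ut")
    case True
    then show ?thesis using dir by (intro exI[of _ 0]) simp
  next
    case False
    then show ?thesis using dir ap by (intro exI[of _ 1]) (simp add: a_ac_def)
  qed
  have \<alpha>1: "\<alpha> \<in> {0..1}"
    using len unfolding is_pred_length_def is_arg_max_def by auto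
  have max: "y \<le> \<alpha>"
    if "y \<in> {0..1}" "pred_point z dx ds y \<in> N_Psi M q (omega_star (2 / 3))" for y
    using len that unfolding is_pred_length_def is_arg_max_def by (auto simp: not_less)
  show adm: "pred_point z dx ds \<alpha> \<in> N_Psi M q (omega_star (2 / 3))"
    using len unfolding is_pred_length_def is_arg_max_def by auto
  have V: "(norm v)\<^sup>2 < v0" using z by (auto simp: z_def N_prox_def feas_z_iff)
  have \<kappa>: "0 \<le> \<kappa>" using V by (simp add: \<kappa>_def kappa_def)
  have n: "1 \<le> n" by (simp add: n_def Suc_le_eq)
  have P: "1 \<le> P" using mult_mono[of 1 "1 + \<kappa>" 1 "sqrt n"] \<kappa> n by (simp add: P_def)
  then have a01: "a \<in> {0..1}" by (simp add: a_def pos_divide_le_eq)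
  have "a * P = 5 / 16" using P by (simp add: a_def)
  then have a_eq: "a * (1 + \<kappa>) * sqrt n = 5 / 16" by (simp only: P_def mult.assoc)
  have "pred_point z dx ds a \<in> N_Psi M q (omega_star (2 / 3))"
  proof -
    obtain \<theta> where "\<theta> = 0 \<or> \<theta> = 1" "is_direction M z (a_ut z + \<theta> *\<^sub>R a_c z) dx ds"
      using \<theta> by blast
    then show ?thesis
      unfolding z_def
      by (rule predictor_step_admissible[OF M z[unfolded z_def], unfolded z_def])
        (use a01 a_eq in \<open>auto simp: \<kappa>_def n_def\<close>)
  qed
  with a01 have a\<alpha>: "a \<le> \<alpha>" by (rule max)
  have "\<alpha> \<noteq> 1"
  proof
    assume "\<alpha> = 1"
    then have "pred_point z dx ds 1 \<in> feas_z M q" using adm by (simp add: N_Psi_def)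
    then show False by (simp add: z_def zero_prod_def feas_z_iff)
  qed
  then have \<alpha>: "0 \<le> \<alpha>" "\<alpha> < 1" using a\<alpha> a01 \<alpha>1 by auto
  have "a * (1 + \<kappa>) * sqrt n \<le> \<alpha> * (1 + \<kappa>) * sqrt n"
    using a\<alpha> \<kappa> n by (intro mult_right_mono) auto
  then have large: "5 / 16 \<le> \<alpha> * (1 + kappa (v0, v)) * sqrt (real CARD('n))"
    unfolding a_eq by (simp only: \<kappa>_def n_def)
  have w': "snd (snd (pred_point z dx ds \<alpha>)) = (1 - \<alpha>) *\<^sub>R (v0, v)" by (simp add: z_def)
  show "ln (mu_star (snd (snd (pred_point z dx ds \<alpha>))))
      \<le> ln (mu_star (v0, v)) - 1 / (4 * sqrt (real CARD('n)))"
    and "0 < mu_star (snd (snd (pred_point z dx ds \<alpha>)))"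
    unfolding w' using mu_star_shrink[OF V \<alpha> large] by blast+
qed

text \<open>
  Rounded up, and read as \<open>0\<close> if negative, this bounds the number of passes that can still begin at \<open>z\<close>.
\<close>
definition budget :: "real \<Rightarrow> 'n::finite point \<Rightarrow> real" where
  "budget \<epsilon> z = 4 * sqrt (real CARD('n)) * ln (mu_star (snd (snd z)) / \<epsilon>)"

lemma budget_pos:
  fixes v :: "real ^ 'n"
  assumes "0 < \<epsilon>" "\<epsilon> < v0" "(norm v)\<^sup>2 < v0"
  shows "0 < budget \<epsilon> (x, s, (v0, v))"
proof -
  have "v0 * (v0 - (norm v)\<^sup>2) \<le> v0 * v0" using assms by (intro mult_left_mono) auto
  then have "v0 \<le> mu_star (v0, v)"
    using assms by (simp add: pos_le_divide_eq power2_eq_square)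
  then have "1 < mu_star (v0, v) / \<epsilon>" using assms by (simp add: pos_less_divide_eq del: mu_star.simps)
  then have "0 < ln (mu_star (v0, v) / \<epsilon>)" by simp
  then show ?thesis by (simp add: budget_def del: mu_star.simps)
qed

fun config_point :: "'n config \<Rightarrow> 'n point" where
  "config_point (Outer z) = z"
| "config_point (Inner z) = z"

fun config_invariant :: "real ^ 'n ^ 'n \<Rightarrow> real ^ 'n \<Rightarrow> real \<Rightarrow> real \<Rightarrow> 'n::finite config \<Rightarrow> bool" where
  "config_invariant M q \<beta> \<tau> (Outer z) \<longleftrightarrow> z \<in> N_prox M q \<beta>"
| "config_invariant M q \<beta> \<tau> (Inner z) \<longleftrightarrow> z \<in> N_Psi M q \<tau>"

text \<open>
  The gain \<open>\<eta>\<close> of a corrector step is the least amount by which any step lowers this potential. A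
  predictor step uses up at least one unit of the budget; the factor \<open>\<tau> + 2 \<eta>\<close> pays for the value \<open>Psi \<le> \<tau>\<close>
  that it introduces. The last predictor step may make the budget arbitrarily negative; cutting it
  off at \<open>-1\<close> keeps the potential nonnegative and still credits a full unit to that step, since the
  budget is positive before it.
\<close>
fun potential :: "real \<Rightarrow> real \<Rightarrow> real \<Rightarrow> 'n::finite config \<Rightarrow> real" where
  "potential \<epsilon> \<tau> \<eta> (Outer z) = (\<tau> + 2 * \<eta>) * (max (budget \<epsilon> z) (- 1) + 1)"
| "potential \<epsilon> \<tau> \<eta> (Inner z) = (\<tau> + 2 * \<eta>) * (max (budget \<epsilon> z) (- 1) + 1) + Psi z + \<eta>"

lemma potential_nonneg:
  assumes "config_invariant M q \<beta> \<tau> cf" "0 \<le> \<tau>" "0 \<le> \<eta>"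
  shows "0 \<le> potential \<epsilon> \<tau> \<eta> cf"
proof (cases cf)
  case (Outer z)
  then show ?thesis using assms by (auto intro!: mult_nonneg_nonneg)
next
  case (Inner z)
  then have "z \<in> feas_z M q" using assms(1) by (simp add: N_Psi_def)
  then have "0 \<le> Psi z" by (rule Psi_nonneg)
  then show ?thesis using assms Inner by (auto intro!: mult_nonneg_nonneg add_nonneg_nonneg)
qed

text \<open>
  The decrease from \<open>corrector_step_decrease\<close> for \<open>\<beta> = 1/4\<close> and \<open>\<tau> = omega_star (2/3)\<close>.
\<close>
definition corrector_gain :: "'n::finite itself \<Rightarrow> real" where
  "corrector_gain _ =
     (1 / 4) ^ 4 / (100 * (real CARD('n) + 1) ^ 5 * exp (omega_star (2 / 3) + 1) ^ 4)"

lemma corrector_gain_pos: "0 < corrector_gain TYPE('n::finite)"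
  by (simp add: corrector_gain_def add_nonneg_pos)

lemma omega_star_two_thirds_nonneg: "0 \<le> omega_star (2 / 3)"
  using omega_star_ge_half_square[of "2 / 3"] by (simp add: power2_eq_square)

lemma pts_step_progress:
  fixes M :: "real ^ 'n ^ 'n" and q :: "real ^ 'n" and ap :: "'n point \<Rightarrow> real ^ 'n"
  defines "\<tau> \<equiv> omega_star (2 / 3)" and "\<eta> \<equiv> corrector_gain TYPE('n)"
  assumes M: "pos_semidef M" and \<epsilon>: "0 < \<epsilon>" and ap: "ap = a_ut \<or> ap = a_ac"
    and inv: "config_invariant M q (1 / 4) \<tau> cf" and step: "pts_step M q \<epsilon> (1 / 4) \<tau> ap cf cf'"
  shows "config_invariant M q (1 / 4) \<tau> cf'"
    and "potential \<epsilon> \<tau> \<eta> cf' \<le> potential \<epsilon> \<tau> \<eta> cf - \<eta>"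
    and "budget \<epsilon> (config_point cf')
      \<le> budget \<epsilon> (config_point cf) - (if \<exists>z. cf = Outer z then 1 else 0)"
    and "\<exists>z. cf = Outer z \<Longrightarrow> 0 < budget \<epsilon> (config_point cf)"
proof -
  have \<tau>: "0 \<le> \<tau>" unfolding \<tau>_def by (rule omega_star_two_thirds_nonneg)
  have \<eta>: "0 < \<eta>" unfolding \<eta>_def by (rule corrector_gain_pos)
  have "config_invariant M q (1 / 4) \<tau> cf' \<and> potential \<epsilon> \<tau> \<eta> cf' \<le> potential \<epsilon> \<tau> \<eta> cf - \<eta> \<and>
    budget \<epsilon> (config_point cf')
      \<le> budget \<epsilon> (config_point cf) - (if \<exists>z. cf = Outer z then 1 else 0) \<and>
    ((\<exists>z. cf = Outer z) \<longrightarrow> 0 < budget \<epsilon> (config_point cf))"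
    using step
  proof (cases rule: pts_step.cases)
    case (predictor z x s v0 v dx ds \<alpha>)
    define z' where "z' = pred_point z dx ds \<alpha>"
    have z: "z \<in> N_prox M q (1 / 4)" using inv predictor by simp
    note prog = predictor_progress[OF M z[unfolded predictor(3)] ap
        predictor(5)[unfolded predictor(3)] predictor(6)[unfolded predictor(3) \<tau>_def],
        folded predictor(3) \<tau>_def z'_def]
    have V: "(norm v)\<^sup>2 < v0" using z by (auto simp: predictor(3) N_prox_def feas_z_iff)
    have b: "0 < budget \<epsilon> z" unfolding predictor(3) by (rule budget_pos[OF \<epsilon> predictor(4) V])
    have \<mu>: "0 < mu_star (v0, v)" using V \<epsilon> predictor(4) by simp
    define n where "n = 4 * sqrt (real CARD('n))"
    have n: "0 < n" by (simp add: n_def)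
    have "ln (mu_star (snd (snd z')) / \<epsilon>) \<le> ln (mu_star (v0, v) / \<epsilon>) - 1 / n"
      using prog(2,3) \<mu> \<epsilon> by (simp add: ln_div n_def del: mu_star.simps)
    then have "n * ln (mu_star (snd (snd z')) / \<epsilon>) \<le> n * (ln (mu_star (v0, v) / \<epsilon>) - 1 / n)"
      using n by (intro mult_left_mono) auto
    also have "\<dots> = n * ln (mu_star (v0, v) / \<epsilon>) - 1" using n by (simp add: right_diff_distrib)
    finally have b': "budget \<epsilon> z' \<le> budget \<epsilon> z - 1"
      by (simp add: budget_def n_def predictor(3) del: mu_star.simps)
    have "max (budget \<epsilon> z') (- 1) + 1 \<le> max (budget \<epsilon> z) (- 1) + 1 - 1" using b b' by simp
    then have "(\<tau> + 2 * \<eta>) * (max (budget \<epsilon> z') (- 1) + 1)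
        \<le> (\<tau> + 2 * \<eta>) * (max (budget \<epsilon> z) (- 1) + 1 - 1)"
      using \<tau> \<eta> by (intro mult_left_mono) auto
    also have "\<dots> = (\<tau> + 2 * \<eta>) * (max (budget \<epsilon> z) (- 1) + 1) - (\<tau> + 2 * \<eta>)"
      by (simp only: right_diff_distrib mult_1_right)
    finally have "potential \<epsilon> \<tau> \<eta> (Inner z') \<le> potential \<epsilon> \<tau> \<eta> (Outer z) - \<eta>"
      using prog(1) by (simp add: N_Psi_def)
    then show ?thesis using prog(1) b b' by (simp add: predictor(1,2) z'_def[symmetric])
  next
    case (corrector z dx ds \<alpha>)
    obtain x s v0 v where z_eq: "z = (x, s, (v0, v))" by (cases z) auto
    have z: "z \<in> N_Psi M q \<tau>" using inv corrector by simp
    note dec = corrector_step_decrease[OF M _ _ \<tau> z[unfolded z_eq] corrector(3-5)[unfolded z_eq],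
        folded z_eq]
    have "corr_point z dx ds \<alpha> \<in> feas_z M q" by (rule dec(1)) auto
    moreover have "Psi (corr_point z dx ds \<alpha>) \<le> Psi z - \<eta>"
      using dec(2) by (simp add: \<eta>_def corrector_gain_def \<tau>_def)
    moreover have "budget \<epsilon> (corr_point z dx ds \<alpha>) = budget \<epsilon> z"
      by (simp add: z_eq budget_def)
    ultimately show ?thesis using z \<eta> by (simp add: corrector(1,2) N_Psi_def)
  next
    case (inner_exit z)
    then have "0 \<le> Psi z" by (auto simp: N_prox_def intro: Psi_nonneg)
    then show ?thesis using inner_exit by simp
  qed
  then show "config_invariant M q (1 / 4) \<tau> cf'"
    and "potential \<epsilon> \<tau> \<eta> cf' \<le> potential \<epsilon> \<tau> \<eta> cf - \<eta>"
    and "budget \<epsilon> (config_point cf')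
      \<le> budget \<epsilon> (config_point cf) - (if \<exists>z. cf = Outer z then 1 else 0)"
    and "\<exists>z. cf = Outer z \<Longrightarrow> 0 < budget \<epsilon> (config_point cf)"
    by blast+
qed

text \<open>
  An execution is stuck only at normal termination: in the corrector loop the direction and the step
  length always exist, and in the outer loop the direction exists and the step length is presupposed.
\<close>
lemma pts_step_possible:
  fixes M :: "real ^ 'n ^ 'n" and q :: "real ^ 'n"
  assumes M: "pos_semidef M" and inv: "config_invariant M q \<beta> \<tau> cf"
    and pred: "\<And>x s v0 v dx ds. cf = Outer (x, s, (v0, v)) \<Longrightarrow> \<epsilon> < v0 \<Longrightarrow>
      is_direction M (x, s, (v0, v)) (ap (x, s, (v0, v))) dx ds \<Longrightarrow>
      \<exists>\<alpha>. is_pred_length M q \<tau> (x, s, (v0, v)) dx ds \<alpha>"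
    and stuck: "\<not> (\<exists>cf'. pts_step M q \<epsilon> \<beta> \<tau> ap cf cf')"
  shows "\<exists>x s v0 v. cf = Outer (x, s, (v0, v)) \<and> v0 \<le> \<epsilon>"
proof (cases cf)
  case (Outer z)
  obtain x s v0 v where z: "z = (x, s, (v0, v))" by (cases z) auto
  have pos: "0 < x $ i" "0 < s $ i" for i
    using inv Outer by (auto simp: z N_prox_def feas_z_iff)
  obtain dx ds where dir: "is_direction M z (ap z) dx ds"
    using direction_exists[OF M pos] unfolding z by blast
  have "v0 \<le> \<epsilon>"
  proof (rule ccontr)
    assume "\<not> v0 \<le> \<epsilon>"
    then have v0: "\<epsilon> < v0" by simp
    then obtain \<alpha> where "is_pred_length M q \<tau> z dx ds \<alpha>"
      using pred[OF Outer[unfolded z] v0 dir[unfolded z]] unfolding z by blast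
    then have "pts_step M q \<epsilon> \<beta> \<tau> ap (Outer z) (Inner (pred_point z dx ds \<alpha>))"
      by (rule pts_step.predictor[where ap = ap, OF z v0 dir])
    then show False using stuck Outer by blast
  qed
  then show ?thesis using Outer z by blast
next
  case (Inner z)
  obtain x s v0 v where z: "z = (x, s, (v0, v))" by (cases z) auto
  have F: "z \<in> feas_z M q" using inv Inner by (simp add: N_Psi_def)
  have pos: "0 < x $ i" "0 < s $ i" for i using F by (auto simp: z feas_z_iff)
  show ?thesis
  proof (cases "z \<in> N_prox M q \<beta>")
    case True
    then show ?thesis using stuck Inner pts_step.inner_exit by blast
  next
    case False
    obtain dx ds where dir: "is_direction M z (a_c z) dx ds"
      using direction_exists[OF M pos] unfolding z by blast
    obtain \<alpha> where "is_corr_length M q z dx ds \<alpha>"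
      using corrector_length_exists[OF F[unfolded z] dir[unfolded z]] unfolding z by blast
    then show ?thesis using stuck Inner pts_step.corrector[OF False dir] by blast
  qed
qed

lemma outer_iterations_Suc:
  "outer_iterations c (Suc k) = outer_iterations c k + (if \<exists>z. c k = Outer z then 1 else 0)"
proof -
  have "{j. j < Suc k \<and> (\<exists>z. c j = Outer z)}
      = {j. j < k \<and> (\<exists>z. c j = Outer z)} \<union> (if \<exists>z. c k = Outer z then {k} else {})"
    by (auto simp: less_Suc_eq)
  then show ?thesis by (simp add: outer_iterations_def)
qed

theorem theorem4p13:
  fixes M :: "real ^ 'n ^ 'n" and q :: "real ^ 'n"
    and \<epsilon> \<beta> \<tau> :: real
    and x0 s0 :: "real ^ 'n" and w0 :: "'n par"
    and ap :: "'n point \<Rightarrow> real ^ 'n"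
    and L :: enat and c :: "nat \<Rightarrow> 'n config"
  assumes "pos_semidef M"
    and "feas_pos M q \<noteq> {}"
    and "\<epsilon> > 0"
    and "\<beta> = 1 / 4"
    and "\<tau> = omega_star (2 * \<beta> / (1 - \<beta>))"
    and "(x0, s0, w0) \<in> N_prox M q \<beta>"
    and "ap = a_ut \<or> ap = a_ac"
    and "pts_run M q \<epsilon> \<beta> \<tau> ap (x0, s0, w0) L c"
  shows "\<exists>K x s v0 v. L = enat K \<and> c K = Outer (x, s, (v0, v)) \<and> v0 \<le> \<epsilon> \<and>
    (x, s) \<in> feas M q \<and> x \<bullet> s \<le> \<epsilon> \<and>
    outer_iterations c K \<le> nat \<lceil>4 * sqrt (real CARD('n)) * ln (mu_star w0 / \<epsilon>)\<rceil>"
proof -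
  define \<eta> where "\<eta> = corrector_gain TYPE('n)"
  define b where "b = budget \<epsilon> (x0, s0, w0)"
  define \<Phi> :: "'n config \<Rightarrow> real" where "\<Phi> = potential \<epsilon> \<tau> \<eta>"
  have \<tau>: "\<tau> = omega_star (2 / 3)" unfolding assms(5) assms(4) by simp
  have c0: "c 0 = Outer (x0, s0, w0)"
    and step: "\<And>k. enat k < L \<Longrightarrow> pts_step M q \<epsilon> \<beta> \<tau> ap (c k) (c (Suc k))"
    and last: "\<And>k. enat k = L \<Longrightarrow> \<not> (\<exists>c'. pts_step M q \<epsilon> \<beta> \<tau> ap (c k) c')"
    using assms(8) by (auto simp: pts_run_def maximal_execution_def)
  note progress = pts_step_progress[OF assms(1,3,7), of q, folded \<tau> \<eta>_def assms(4)]
  have inv: "config_invariant M q \<beta> \<tau> (c k) \<and> \<Phi> (c k) \<le> \<Phi> (c 0) - real k * \<eta> \<and>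
      budget \<epsilon> (config_point (c k)) \<le> b - real (outer_iterations c k) \<and>
      outer_iterations c k \<le> nat \<lceil>b\<rceil>" if "enat k \<le> L" for k
    using that
  proof (induction k)
    case 0
    then show ?case using assms(6) by (simp add: c0 b_def outer_iterations_def)
  next
    case (Suc k)
    have lt: "enat k < L" using Suc.prems Suc_ile_eq by blast
    then have IH: "config_invariant M q \<beta> \<tau> (c k)" "\<Phi> (c k) \<le> \<Phi> (c 0) - real k * \<eta>"
      "budget \<epsilon> (config_point (c k)) \<le> b - real (outer_iterations c k)"
      "outer_iterations c k \<le> nat \<lceil>b\<rceil>"
      using Suc.IH by simp_all
    note prog = progress[OF IH(1) step[OF lt]]
    have "\<Phi> (c (Suc k)) \<le> \<Phi> (c 0) - real (Suc k) * \<eta>"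
      using prog(2) IH(2) by (simp add: \<Phi>_def distrib_right)
    moreover have "budget \<epsilon> (config_point (c (Suc k))) \<le> b - real (outer_iterations c (Suc k))"
      using prog(3) IH(3) by (simp add: outer_iterations_Suc split: if_splits)
    moreover have "outer_iterations c (Suc k) \<le> nat \<lceil>b\<rceil>"
    proof (cases "\<exists>z. c k = Outer z")
      case True
      then have "real (outer_iterations c k) < b" using prog(4) IH(3) by simp
      \<comment> \<open>A pass begins only if the budget before it is positive, so the last pass may overdraw the
        budget by less than one unit; this is absorbed by the ceiling.\<close>
      then have "outer_iterations c k < nat \<lceil>b\<rceil>" by linarith
      then show ?thesis by (simp add: outer_iterations_Suc)
    next
      case False
      then show ?thesis using IH(4) by (simp add: outer_iterations_Suc)
    qed
    ultimately show ?case using prog(1) by blast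
  qed
  have \<eta>: "0 < \<eta>" unfolding \<eta>_def by (rule corrector_gain_pos)
  have \<Phi>0: "0 \<le> \<Phi> (c k)" if "enat k \<le> L" for k
    unfolding \<Phi>_def
    using inv[OF that] \<eta> omega_star_two_thirds_nonneg \<tau> by (intro potential_nonneg) auto
  have "L \<noteq> \<infinity>"
  proof
    assume "L = \<infinity>"
    obtain k :: nat where "\<Phi> (c 0) < real k * \<eta>" using reals_Archimedean3[OF \<eta>] by blast
    then show False using inv[of k] \<Phi>0[of k] \<open>L = \<infinity>\<close> by simp
  qed
  then obtain K where K: "L = enat K" by auto
  have invK: "config_invariant M q \<beta> \<tau> (c K)" "outer_iterations c K \<le> nat \<lceil>b\<rceil>"
    using inv[of K] K by simp_all
  have "\<exists>x s v0 v. c K = Outer (x, s, (v0, v)) \<and> v0 \<le> \<epsilon>"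
  proof (rule pts_step_possible[OF assms(1) invK(1)])
    show "\<not> (\<exists>cf'. pts_step M q \<epsilon> \<beta> \<tau> ap (c K) cf')" using last K by simp
    show "\<exists>\<alpha>. is_pred_length M q \<tau> (x, s, (v0, v)) dx ds \<alpha>"
      if "c K = Outer (x, s, (v0, v))" "\<epsilon> < v0"
        "is_direction M (x, s, (v0, v)) (ap (x, s, (v0, v))) dx ds" for x s v0 v dx ds
      using assms(8) that K unfolding pts_run_def by (metis order_refl)
  qed
  then obtain x s v0 v where fin: "c K = Outer (x, s, (v0, v))" "v0 \<le> \<epsilon>" by blast
  then have "(x, s, (v0, v)) \<in> feas_z M q" using invK(1) by (simp add: N_prox_def)
  then have "(x, s) \<in> feas M q" "x \<bullet> s \<le> \<epsilon>"
    using fin(2) by (auto simp: feas_z_def feas_pos_def)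
  then show ?thesis
    using K fin invK(2) by (auto simp: b_def budget_def)
qed

end
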